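(* Let $p>3$ be a prime, $c\in\mathbb{Z}_p$ and $c(c^2+3)\not\equiv 0\pmod p$. Then $$\sum_{k=1}^{[p/3]}\binom{3k}{k}\Big(\frac{4}{9(c^2+3)}\Big)^k\equiv\begin{cases}0\pmod p&\text{if }c\in C_0(p),\\-\frac{3(c+1)}{2c}\pmod p&\text{if }c\in C_1(p),\\-\frac{3(c-1)}{2c}\pmod p&\text{if }c\in C_2(p).\end{cases}$$
   Context: For a prime $p$, $\mathbb{Z}_p$ denotes the set of rational numbers whose denominator is not divisible by $p$; congruences modulo $p$ are taken in this ring. $[x]$ is the greatest integer not exceeding $x$. Let $\omega=\frac{-1+\sqrt{-3}}{2}$. For a prime element $\pi$ of $\mathbb{Z}[\omega]$ not dividing $3$ and $\alpha\in\mathbb{Z}[\omega]$ with $\pi\nmid\alpha$, the cubic residue symbol $\big(\frac{\alpha}{\pi}\big)_3\in\{1,\omega,\omega^2\}$ is defined by $\alpha^{(N\pi-1)/3}\equiv\big(\frac{\alpha}{\pi}\big)_3\pmod\pi$, with $N$ the norm. For a prime $p>3$ the cubic Jacobi symbol $\big(\frac{a+b\omega}{p}\big)_3$ (for $a+b\omega$ coprime to $p$) is the product of the symbols $\big(\frac{a+b\omega}{\pi}\big)_3$ over the prime factors $\pi$ of $p$ in $\mathbb{Z}[\omega]$ (one factor $\pi=p$ if $p\equiv 2\pmod 3$, two conjugate factors if $p\equiv 1\pmod 3$); for $a,b\in\mathbb{Z}_p$ it is evaluated by replacing $a,b$ by integers congruent to them modulo $p$. For $c\in\mathbb{Z}_p$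 with $c^2+3\not\equiv 0\pmod p$ and $r\in\{0,1,2\}$, one writes $c\in C_r(p)$ if and only if $\big(\frac{c+1+2\omega}{p}\big)_3=\omega^r$. *)

theory Defs
  imports Complex_Main "HOL-Computational_Algebra.Primes" "HOL-Library.Multiset"
begin

section \<open>The ring $\mathbb{Z}[\omega]$\<close>

text \<open>\<open>Eisenstein a b\<close> stands for $a + b\omega$ with $\omega = (-1+\sqrt{-3})/2$; the product uses
  $\omega^2 = -1-\omega$. The map \<open>to_complex\<close> below identifies the type with the subring
  $\mathbb{Z}[\omega]$ of the complex numbers.\<close>

datatype eisenstein = Eisenstein (int_part: int) (omega_part: int)

lemma eisenstein_eq_iff:
  "x = y \<longleftrightarrow> int_part x = int_part y \<and> omega_part x = omega_part y"
  by (auto intro: eisenstein.expand)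

instantiation eisenstein :: comm_ring_1
begin

definition zero_eisenstein :: eisenstein where
  "0 = Eisenstein 0 0"

definition one_eisenstein :: eisenstein where
  "1 = Eisenstein 1 0"

definition plus_eisenstein :: "eisenstein \<Rightarrow> eisenstein \<Rightarrow> eisenstein" where
  "x + y = Eisenstein (int_part x + int_part y) (omega_part x + omega_part y)"

definition uminus_eisenstein :: "eisenstein \<Rightarrow> eisenstein" where
  "- x = Eisenstein (- int_part x) (- omega_part x)"

definition minus_eisenstein :: "eisenstein \<Rightarrow> eisenstein \<Rightarrow> eisenstein" where
  "x - y = Eisenstein (int_part x - int_part y) (omega_part x - omega_part y)"

definition times_eisenstein :: "eisenstein \<Rightarrow> eisenstein \<Rightarrow> eisenstein" where
  "x * y = Eisenstein
     (int_part x * int_part y - omega_part x * omega_part y)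
     (int_part x * omega_part y + omega_part x * int_part y - omega_part x * omega_part y)"

instance
  by standard
    (simp_all add: eisenstein_eq_iff zero_eisenstein_def one_eisenstein_def plus_eisenstein_def
      uminus_eisenstein_def minus_eisenstein_def times_eisenstein_def algebra_simps)

end

definition omega :: eisenstein where
  "omega = Eisenstein 0 1"

definition to_complex :: "eisenstein \<Rightarrow> complex" where
  "to_complex x = of_int (int_part x) + of_int (omega_part x) * ((- 1 + \<i> * sqrt 3) / 2)"

lemma to_complex_omega: "to_complex omega = (- 1 + \<i> * sqrt 3) / 2"
  by (simp add: to_complex_def omega_def)

lemma to_complex_0: "to_complex 0 = 0"
  by (simp add: to_complex_def zero_eisenstein_def)

lemma to_complex_1: "to_complex 1 = 1"
  by (simp add: to_complex_def one_eisenstein_def)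

lemma to_complex_add: "to_complex (x + y) = to_complex x + to_complex y"
  by (simp only: to_complex_def plus_eisenstein_def eisenstein.sel of_int_add distrib_right ac_simps)

lemma to_complex_mult: "to_complex (x * y) = to_complex x * to_complex y"
proof -
  define w :: complex where "w = (- 1 + \<i> * sqrt 3) / 2"
  have w2: "w * w = - 1 - w"
    by (simp add: w_def complex_eq_iff field_simps)
  have "(of_int a + of_int b * w) * (of_int c + of_int d * w) =
      of_int a * of_int c + (of_int a * of_int d + of_int b * of_int c) * w
        + of_int b * of_int d * (w * w)" for a b c d :: int
    by (simp add: algebra_simps)
  then show ?thesis
    unfolding to_complex_def times_eisenstein_def w_def [symmetric] w2
    by (simp add: algebra_simps)
qed

lemma inj_to_complex: "inj to_complex"
  by (rule injI) (auto simp: to_complex_def complex_eq_iff eisenstein_eq_iff)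

definition eis_norm :: "eisenstein \<Rightarrow> nat" where
  "eis_norm x = nat ((int_part x)\<^sup>2 - int_part x * omega_part x + (omega_part x)\<^sup>2)"

lemma eis_norm_eq: "real (eis_norm x) = (cmod (to_complex x))\<^sup>2"
proof -
  define a b where "a = int_part x" and "b = omega_part x"
  have "Re (to_complex x) = a - b / 2" "Im (to_complex x) = b * sqrt 3 / 2"
    by (simp_all add: to_complex_def a_def b_def)
  note parts = this
  have eq: "(cmod (to_complex x))\<^sup>2 = real_of_int (a\<^sup>2 - a * b + b\<^sup>2)"
    unfolding cmod_power2 parts by (simp add: power_divide power_mult_distrib power2_diff)
  have "real_of_int (a\<^sup>2 - a * b + b\<^sup>2) \<ge> 0"
    unfolding eq [symmetric] by simp
  then have "a\<^sup>2 - a * b + b\<^sup>2 \<ge> 0"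
    by linarith
  then show ?thesis
    unfolding eq by (simp add: eis_norm_def a_def b_def)
qed

section \<open>Cubic residue and Jacobi symbols\<close>

text \<open>Meaningful only for a prime element \<open>\<pi>\<close> that divides neither 3 nor \<open>\<alpha>\<close>.\<close>

definition cubic_residue_symbol :: "eisenstein \<Rightarrow> eisenstein \<Rightarrow> eisenstein" where
  "cubic_residue_symbol \<alpha> \<pi> =
     (THE z. z \<in> {1, omega, omega ^ 2} \<and> \<pi> dvd \<alpha> ^ ((eis_norm \<pi> - 1) div 3) - z)"

text \<open>The product of the symbols over the prime factors of \<open>p\<close>, taken with multiplicity. The symbol
  depends on the prime element only up to associates, so every factorization
  \<open>p = \<Prod>\<^sub># F\<close> into prime elements yields the same value. Meaningful only for
  \<open>p\<close> coprime to 3 and to \<open>\<alpha>\<close>.\<close>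

definition cubic_jacobi :: "eisenstein \<Rightarrow> nat \<Rightarrow> eisenstein" where
  "cubic_jacobi \<alpha> p =
     (THE z. \<exists>F. (\<forall>\<pi>\<in>#F. prime_elem \<pi>) \<and> prod_mset F = of_nat p \<and>
        z = (\<Prod>\<pi>\<in>#F. cubic_residue_symbol \<alpha> \<pi>))"

section \<open>The rationals integral at a prime\<close>

definition p_integral :: "nat \<Rightarrow> rat set" where
  "p_integral p = {x. \<not> int p dvd snd (quotient_of x)}"

definition cong_p :: "nat \<Rightarrow> rat \<Rightarrow> rat \<Rightarrow> bool" where
  "cong_p p x y \<longleftrightarrow>
     x \<in> p_integral p \<and> y \<in> p_integral p \<and> (\<exists>z\<in>p_integral p. x - y = of_nat p * z)"

text \<open>The cubic Jacobi symbol of $a + b\omega$ for \<open>p\<close>-integral rationals \<open>a\<close> and \<open>b\<close>. The value does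
  not depend on the chosen integer representatives.\<close>

definition cubic_jacobi_rat :: "rat \<Rightarrow> rat \<Rightarrow> nat \<Rightarrow> eisenstein" where
  "cubic_jacobi_rat a b p =
     (THE z. \<exists>m n :: int. cong_p p (of_int m) a \<and> cong_p p (of_int n) b \<and>
        z = cubic_jacobi (Eisenstein m n) p)"

definition cubic_class :: "nat \<Rightarrow> nat \<Rightarrow> rat set" where
  "cubic_class r p =
     {c \<in> p_integral p. \<not> cong_p p (c\<^sup>2 + 3) 0 \<and> cubic_jacobi_rat (c + 1) 2 p = omega ^ r}"

end

(*
  Put n = [p/3] and alpha = c + 1 + 2 omega = c + sqrt (-3), with conjugate beta, so that
  alpha + beta = 2 c, (alpha - beta)^2 = -12 and alpha beta = c^2 + 3. Modulo p one has
  binom(3k, k) = binom(n + k, 2k) (-27)^k for k <= n, and the identity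
    (a + b) sum_k binom(n + k, 2k) (a - b)^(2k) (a b)^(n - k) = a^(2n+1) + b^(2n+1)
  evaluates the sum over 0 <= k <= n to
    (alpha^(2n+1) + beta^(2n+1)) / (2 c (alpha beta)^n).
  If p = 3n + 1, the Jacobi symbol z satisfies alpha^n = z beta^n; if p = 3n + 2, then
  alpha^p = beta turns its definition into beta^(n+1) = z alpha^(n+1). In both cases the quotient
  becomes (z alpha + z^-1 beta) / (2 c).
*)

theory Submission
  imports Defs "HOL-Number_Theory.Number_Theory" "HOL-Library.Discrete_Functions"
begin

section \<open>Arithmetic of Eisenstein integers\<close>

text \<open>Both symbols are definite descriptions, and the Jacobi symbol ranges over all
  factorizations of p. Before a value can be used it must be shown to exist and to be the same for
  every factorization. Both follow from the relations alpha^n = z beta^n and beta^(n+1) = z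
  alpha^(n+1): each factorization yields a cube root of unity z that satisfies the relation
  belonging to p, only one z does, and explicit factorizations exist, for p = 1 modulo 3 because p
  is then a norm. The factor 4/9 is there because (-27)(4/9) = -12 = (alpha - beta)^2; so modulo p
  the k-th term of the sum is binom(n + k, 2k) (alpha - beta)^(2k) (alpha beta)^(-k). For z = 1,
  omega, omega^2 the integer combination z alpha + z^-1 beta is 2c, -c - 3, -c + 3. Division by 2c
  and removal of the term 1 at k = 0 give the three stated values.\<close>

lemmas eisenstein_defs = zero_eisenstein_def one_eisenstein_def plus_eisenstein_def
  uminus_eisenstein_def minus_eisenstein_def times_eisenstein_def

instance eisenstein :: idom
proof
  fix x y :: eisenstein
  assume "x \<noteq> 0" "y \<noteq> 0"
  then show "x * y \<noteq> 0"
    by (metis inj_eq inj_to_complex mult_eq_0_iff to_complex_0 to_complex_mult)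
qed

lemma of_nat_eisenstein: "of_nat k = Eisenstein (int k) 0"
  by (induction k) (simp_all add: eisenstein_defs)

lemma of_int_eisenstein: "of_int k = Eisenstein k 0"
  by (cases k rule: int_cases2) (simp_all add: of_nat_eisenstein eisenstein_defs)

lemma of_int_dvd_eisenstein_iff:
  "of_int k dvd x \<longleftrightarrow> k dvd int_part x \<and> k dvd omega_part x"
proof
  assume "k dvd int_part x \<and> k dvd omega_part x"
  then obtain a b where "int_part x = k * a" "omega_part x = k * b"
    by (auto elim!: dvdE)
  then have "x = of_int k * Eisenstein a b"
    by (simp add: eisenstein_eq_iff of_int_eisenstein eisenstein_defs)
  then show "of_int k dvd x"
    by simp
qed (auto simp: dvd_def of_int_eisenstein eisenstein_defs)

lemma of_int_dvd_of_int_eisenstein_iff: "of_int k dvd (of_int l :: eisenstein) \<longleftrightarrow> k dvd l"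
  unfolding of_int_dvd_eisenstein_iff by (simp add: of_int_eisenstein)

definition eis_cnj :: "eisenstein \<Rightarrow> eisenstein" where
  "eis_cnj x = Eisenstein (int_part x - omega_part x) (- omega_part x)"

lemma eis_cnj_mult [simp]: "eis_cnj (x * y) = eis_cnj x * eis_cnj y"
  by (simp add: eis_cnj_def eisenstein_defs algebra_simps)

lemma eis_cnj_diff [simp]: "eis_cnj (x - y) = eis_cnj x - eis_cnj y"
  by (simp add: eis_cnj_def eisenstein_defs)

lemma eis_cnj_1 [simp]: "eis_cnj 1 = 1"
  by (simp add: eis_cnj_def eisenstein_defs)

lemma eis_cnj_power [simp]: "eis_cnj (x ^ k) = eis_cnj x ^ k"
  by (induction k) simp_all

lemma eis_cnj_cnj [simp]: "eis_cnj (eis_cnj x) = x"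
  by (simp add: eis_cnj_def eisenstein_eq_iff)

lemma eis_cnj_dvd: "x dvd y \<Longrightarrow> eis_cnj x dvd eis_cnj y"
  by (auto elim!: dvdE)

lemma mult_eis_cnj: "x * eis_cnj x = of_nat (eis_norm x)"
proof -
  \<comment> \<open>\<open>eis_norm\<close> is defined through \<open>nat\<close>, which would
    truncate a negative value; completing the square excludes that.\<close>
  have "real_of_int ((int_part x)\<^sup>2 - int_part x * omega_part x + (omega_part x)\<^sup>2)
      = (real_of_int (int_part x) - omega_part x / 2)\<^sup>2 + 3 / 4 * (real_of_int (omega_part x))\<^sup>2"
    by (simp add: power2_eq_square field_simps)
  also have "\<dots> \<ge> 0"
    by simp
  finally have "(int_part x)\<^sup>2 - int_part x * omega_part x + (omega_part x)\<^sup>2 \<ge> 0"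
    by linarith
  then show ?thesis
    by (simp add: of_nat_eisenstein eis_norm_def eis_cnj_def eisenstein_defs power2_eq_square
        algebra_simps)
qed

lemma int_eis_norm:
  "int (eis_norm x) = (int_part x)\<^sup>2 - int_part x * omega_part x + (omega_part x)\<^sup>2"
  using arg_cong [OF mult_eis_cnj [of x], of int_part]
  by (simp add: of_nat_eisenstein eis_cnj_def eisenstein_defs power2_eq_square algebra_simps)

lemma eis_norm_mult: "eis_norm (x * y) = eis_norm x * eis_norm y"
proof -
  have "real (eis_norm (x * y)) = real (eis_norm x * eis_norm y)"
    by (simp add: eis_norm_eq to_complex_mult norm_mult power_mult_distrib)
  then show ?thesis
    by (simp only: of_nat_eq_iff)
qed

lemma eis_norm_power: "eis_norm (x ^ k) = eis_norm x ^ k"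
  by (induction k) (simp_all add: eis_norm_mult, simp add: eis_norm_def one_eisenstein_def)

lemma eis_norm_of_nat [simp]: "eis_norm (of_nat k) = k ^ 2"
  by (simp add: eis_norm_def of_nat_eisenstein nat_power_eq)

lemma eis_norm_dvd: "x dvd y \<Longrightarrow> eis_norm x dvd eis_norm y"
  by (auto elim!: dvdE simp: eis_norm_mult)

lemma eis_norm_eq_1_iff: "eis_norm x = 1 \<longleftrightarrow> x dvd 1"
proof
  assume "eis_norm x = 1"
  then have "x * eis_cnj x = 1"
    by (simp add: mult_eis_cnj)
  then show "x dvd 1"
    by (metis dvdI)
next
  assume "x dvd 1"
  then have "eis_norm x dvd eis_norm 1"
    by (rule eis_norm_dvd)
  then show "eis_norm x = 1"
    by (simp add: eis_norm_def one_eisenstein_def)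
qed

lemma eis_norm_prime_elem_neq_1: "prime_elem \<pi> \<Longrightarrow> eis_norm \<pi> \<noteq> 1"
  by (metis eis_norm_eq_1_iff prime_elem_def)

section \<open>Cube roots of unity\<close>

definition cube_roots :: "eisenstein set" where
  "cube_roots = {1, omega, omega\<^sup>2}"

lemma omega_square: "omega\<^sup>2 = Eisenstein (- 1) (- 1)"
  by (simp add: power2_eq_square omega_def eisenstein_defs)

lemma omega_cube: "omega ^ 3 = 1"
  by (simp add: power3_eq_cube omega_def eisenstein_defs)

lemma cube_roots_cnj: "z \<in> cube_roots \<Longrightarrow> z * eis_cnj z = 1"
  by (auto simp: cube_roots_def omega_square) (simp_all add: omega_def eis_cnj_def eisenstein_defs)

lemma cube_roots_mult: "y \<in> cube_roots \<Longrightarrow> z \<in> cube_roots \<Longrightarrow> y * z \<in> cube_roots"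
  by (auto simp: cube_roots_def omega_square) (simp_all add: omega_def eisenstein_defs)

lemma cube_minus_one_factorization:
  "(x - 1) * (x - omega) * (x - omega\<^sup>2) = x ^ 3 - (1 :: eisenstein)"
  by (simp add: omega_square power3_eq_cube eisenstein_eq_iff)
    (simp add: omega_def eisenstein_defs algebra_simps)

text \<open>The differences are associates of 1 - omega. A prime element whose norm does not divide
  3 therefore separates the cube roots, which makes the symbols unique.\<close>

lemma cube_roots_norm_diff:
  "y \<in> cube_roots \<Longrightarrow> z \<in> cube_roots \<Longrightarrow> y \<noteq> z \<Longrightarrow> eis_norm (y - z) = 3"
  by (auto simp: cube_roots_def omega_square)
    (simp_all add: omega_def eis_norm_def eisenstein_defs)

section \<open>Fermat and Frobenius congruences\<close>

lemma dvd_power_diff: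
  fixes x y :: "'a :: comm_ring_1"
  assumes "a dvd x - y"
  shows "a dvd x ^ k - y ^ k"
proof (induction k)
  case (Suc k)
  have "x ^ Suc k - y ^ Suc k = x * (x ^ k - y ^ k) + (x - y) * y ^ k"
    by (simp add: algebra_simps)
  then show ?case
    using Suc assms by simp
qed simp

lemma prime_dvd_add_power_diff:
  fixes x y :: "'a :: comm_ring_1"
  assumes "prime p"
  shows "of_nat p dvd (x + y) ^ p - (x ^ p + y ^ p)"
proof -
  have "p > 0"
    using assms by (rule prime_gt_0_nat)
  then have "{..p} = insert 0 (insert p {1..<p})"
    by auto
  then have "(x + y) ^ p = x ^ p + y ^ p + (\<Sum>k = 1..<p. of_nat (p choose k) * x ^ k * y ^ (p - k))"
    using \<open>p > 0\<close> by (simp add: binomial_ring add_ac)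
  moreover have "of_nat p dvd (\<Sum>k = 1..<p. of_nat (p choose k) * x ^ k * y ^ (p - k))"
  proof (intro dvd_sum dvd_mult2)
    fix k assume "k \<in> {1..<p}"
    then have "p dvd p choose k"
      using assms by (intro dvd_choose_prime) auto
    then show "of_nat p dvd (of_nat (p choose k) :: 'a)"
      by (auto elim!: dvdE)
  qed
  ultimately show ?thesis
    by simp
qed

lemma prime_dvd_power_diff_int:
  assumes "prime p"
  shows "int p dvd a ^ p - a"
proof -
  define b where "b = nat (a mod int p)"
  have p: "p > 0"
    using assms by (rule prime_gt_0_nat)
  have b: "int p dvd a - int b"
    using p by (simp add: b_def mod_eq_dvd_iff [symmetric])
  have "[b ^ p = b] (mod p)"
  proof (cases "p dvd b")
    case True
    then show ?thesis
      using p dvd_trans [OF True dvd_power [of p b]] by (simp add: cong_def dvd_imp_mod_0)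
  next
    case False
    then have "[b * b ^ (p - 1) = b * 1] (mod p)"
      by (intro cong_scalar_left fermat_theorem assms)
    then show ?thesis
      using p by (simp add: power_eq_if)
  qed
  then have "int p dvd int b ^ p - int b"
    by (metis cong_iff_dvd_diff cong_int_iff of_nat_power)
  moreover have "int p dvd a ^ p - int b ^ p"
    using b by (rule dvd_power_diff)
  ultimately have "int p dvd (a ^ p - int b ^ p) + (int b ^ p - int b) - (a - int b)"
    using b by (metis dvd_add dvd_diff)
  then show ?thesis
    by simp
qed

lemma of_nat_dvd_eisenstein_iff:
  "of_nat k dvd x \<longleftrightarrow> int k dvd int_part x \<and> int k dvd omega_part x"
  using of_int_dvd_eisenstein_iff [of "int k" x] by simp

text \<open>Modulo p the p-th power map is additive and fixes the integers, so it acts on omega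
  alone. Whether omega^p is omega or its conjugate is what distinguishes the two residue classes of
  p modulo 3.\<close>

lemma prime_dvd_eisenstein_power_diff:
  assumes "prime p"
  shows "of_nat p dvd x ^ p - (of_int (int_part x) + of_int (omega_part x) * omega ^ p)"
proof -
  define a b where "a = int_part x" and "b = omega_part x"
  have x: "x = of_int a + of_int b * omega"
    by (simp add: a_def b_def of_int_eisenstein omega_def eisenstein_defs)
  have fermat: "of_nat p dvd (of_int (c ^ p - c) :: eisenstein)" for c
    using prime_dvd_power_diff_int [OF assms, of c] of_int_dvd_of_int_eisenstein_iff
    by (metis of_int_of_nat_eq)
  have "x ^ p - (of_int a + of_int b * omega ^ p)
      = (x ^ p - (of_int a ^ p + (of_int b * omega) ^ p)) + of_int (a ^ p - a)
        + of_int (b ^ p - b) * omega ^ p"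
    by (simp add: algebra_simps)
  moreover have "of_nat p dvd x ^ p - (of_int a ^ p + (of_int b * omega) ^ p)"
    unfolding x by (rule prime_dvd_add_power_diff [OF assms])
  ultimately show ?thesis
    unfolding a_def b_def using fermat by (metis dvd_add dvd_mult2)
qed

lemma omega_power_mod: "omega ^ k = omega ^ (k mod 3)"
proof -
  have "omega ^ k = omega ^ (3 * (k div 3) + k mod 3)"
    by simp
  then show ?thesis
    by (simp only: power_add power_mult omega_cube power_one mult_1)
qed

lemma split_prime_dvd_power_diff:
  fixes x :: eisenstein
  assumes "prime p" "p mod 3 = 1"
  shows "of_nat p dvd x ^ p - x"
proof -
  have "omega ^ p = omega"
    using omega_power_mod [of p] assms(2) by simp
  then have "x = of_int (int_part x) + of_int (omega_part x) * omega ^ p"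
    by (simp add: of_int_eisenstein omega_def eisenstein_defs)
  then show ?thesis
    using prime_dvd_eisenstein_power_diff [OF assms(1), of x] by simp
qed

lemma inert_prime_dvd_power_diff_cnj:
  assumes "prime p" "p mod 3 = 2"
  shows "of_nat p dvd x ^ p - eis_cnj x"
proof -
  have "eis_cnj x = of_int (int_part x) + of_int (omega_part x) * omega ^ p"
    using assms(2)
    by (simp add: omega_power_mod [of p] omega_square of_int_eisenstein eis_cnj_def eisenstein_defs)
  then show ?thesis
    using prime_dvd_eisenstein_power_diff [OF assms(1), of x] by simp
qed

lemma eis_cnj_of_nat [simp]: "eis_cnj (of_nat k) = of_nat k"
  by (simp add: of_nat_eisenstein eis_cnj_def)

text \<open>Raising to the p-th power is conjugation modulo p, and two conjugations cancel. The
  exponent is the norm of p, as \<open>cubic_residue_symbol\<close> requires it.\<close>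

lemma inert_prime_dvd_power_diff:
  fixes x :: eisenstein
  assumes "prime p" "p mod 3 = 2"
  shows "of_nat p dvd x ^ p\<^sup>2 - x"
proof -
  have "of_nat p dvd (x ^ p) ^ p - eis_cnj (x ^ p)"
    by (rule inert_prime_dvd_power_diff_cnj [OF assms])
  moreover have "of_nat p dvd eis_cnj (x ^ p) - x"
    using eis_cnj_dvd [OF inert_prime_dvd_power_diff_cnj [OF assms, of x]] by simp
  ultimately have "of_nat p dvd ((x ^ p) ^ p - eis_cnj (x ^ p)) + (eis_cnj (x ^ p) - x)"
    by (rule dvd_add)
  then show ?thesis
    by (simp add: power_mult power2_eq_square)
qed

section \<open>Splitting of rational primes\<close>

text \<open>Modulo p the conjugate of x is x^p, so the hypothesis says that x^(p+1) vanishes. As p +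
  1 is at most p^2, so does x^(p^2), which is congruent to x.\<close>

lemma inert_prime_dvd_norm_imp_dvd:
  assumes "prime p" "p mod 3 = 2" "p dvd eis_norm x"
  shows "of_nat p dvd x"
proof -
  have "of_nat p dvd x * eis_cnj x"
    using assms(3) by (auto simp: mult_eis_cnj elim!: dvdE)
  moreover have "of_nat p dvd x * (x ^ p - eis_cnj x)"
    by (intro dvd_mult inert_prime_dvd_power_diff_cnj assms)
  ultimately have "of_nat p dvd x * (x ^ p - eis_cnj x) + x * eis_cnj x"
    by (intro dvd_add)
  then have "of_nat p dvd x ^ Suc p"
    by (simp add: algebra_simps)
  moreover have "Suc p \<le> p\<^sup>2"
  proof -
    have "p * 2 \<le> p * p"
      using prime_ge_2_nat [OF assms(1)] by (intro mult_le_mono2)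
    then show ?thesis
      using prime_ge_2_nat [OF assms(1)] unfolding power2_eq_square by linarith
  qed
  ultimately have "of_nat p dvd x ^ p\<^sup>2"
    by (meson dvd_trans le_imp_power_dvd)
  moreover have "of_nat p dvd x ^ p\<^sup>2 - x"
    by (rule inert_prime_dvd_power_diff [OF assms(1,2)])
  ultimately have "of_nat p dvd x ^ p\<^sup>2 - (x ^ p\<^sup>2 - x)"
    by (rule dvd_diff)
  then show ?thesis
    by simp
qed

lemma of_nat_prime_not_dvd_norm_eq:
  assumes "prime p" "eis_norm x = p"
  shows "\<not> of_nat p dvd x"
proof
  assume "of_nat p dvd x"
  then have "p\<^sup>2 dvd p ^ 1"
    using eis_norm_dvd assms(2) by fastforce
  then show False
    using assms(1) by (metis le_imp_power_dvd nat_dvd_1_iff_1 not_prime_unit numeral_le_one_iff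
        one_le_numeral power_dvd_imp_le prime_gt_1_nat semiring_norm(69))
qed

lemma inert_prime_elem:
  assumes "prime p" "p mod 3 = 2"
  shows "prime_elem (of_nat p :: eisenstein)"
proof (rule prime_elemI)
  show "of_nat p \<noteq> (0 :: eisenstein)"
    using assms by (auto simp: of_nat_eisenstein zero_eisenstein_def prime_gt_0_nat)
  show "\<not> of_nat p dvd (1 :: eisenstein)"
    using assms by (auto simp: of_nat_dvd_eisenstein_iff one_eisenstein_def)
next
  fix x y :: eisenstein
  assume "of_nat p dvd x * y"
  then have "p\<^sup>2 dvd eis_norm x * eis_norm y"
    using eis_norm_dvd by (metis eis_norm_mult eis_norm_of_nat)
  then have "p dvd eis_norm x * eis_norm y"
    by (metis dvd_mult_left power2_eq_square)
  then have "p dvd eis_norm x \<or> p dvd eis_norm y"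
    using assms(1) by (simp add: prime_dvd_mult_iff)
  then show "of_nat p dvd x \<or> of_nat p dvd y"
    using inert_prime_dvd_norm_imp_dvd assms by blast
qed

lemma norm_prime_imp_dvd: "eis_norm \<pi> = p \<Longrightarrow> \<pi> dvd of_nat p"
  by (metis dvd_triv_left mult_eis_cnj)

text \<open>Modulo such an element everything is congruent to an integer, so a product can be tested
  on integers k and l; taking norms turns divisibility of k l into p dividing (k l)^2.\<close>

lemma prime_elem_norm_prime:
  assumes p: "prime p" and norm: "eis_norm \<pi> = p"
  shows "prime_elem \<pi>"
proof (rule prime_elemI)
  show "\<pi> \<noteq> 0"
    using assms by (auto simp: eis_norm_def zero_eisenstein_def)
  show "\<not> \<pi> dvd 1"
    using assms eis_norm_eq_1_iff not_prime_1 by metis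
next
  fix x y assume xy: "\<pi> dvd x * y"
  define a b where "a = int_part \<pi>" and "b = omega_part \<pi>"
  have pp: "prime (int p)"
    using p by simp
  have pi: "\<pi> dvd of_nat p"
    using norm by (rule norm_prime_imp_dvd)
  have \<pi>: "\<pi> = of_int a + of_int b * omega"
    by (simp add: a_def b_def of_int_eisenstein omega_def eisenstein_defs)
  have N: "int p = a\<^sup>2 - a * b + b\<^sup>2"
    using int_eis_norm [of \<pi>] norm by (simp add: a_def b_def)
  \<comment> \<open>Otherwise p would divide a^2 = p + a b - b^2, hence the element itself.\<close>
  have "\<not> int p dvd b"
  proof
    assume b: "int p dvd b"
    then have "int p dvd int p + a * b - b\<^sup>2"
      by (simp add: power2_eq_square)
    then have "int p dvd a"
      using N pp by (simp add: prime_dvd_power_iff)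
    with b have "of_nat p dvd \<pi>"
      by (simp add: of_nat_dvd_eisenstein_iff a_def b_def)
    then show False
      using of_nat_prime_not_dvd_norm_eq [OF p norm] by blast
  qed
  then have "coprime b (int p)"
    using pp by (metis coprime_commute prime_imp_coprime)
  then obtain b' where "[b * b' = 1] (mod int p)"
    using cong_solve_coprime_int by blast
  then have "int p dvd b * b' - 1"
    by (simp add: cong_iff_dvd_diff)
  then have "of_nat p dvd (of_int (b * b' - 1) :: eisenstein)"
    using of_int_dvd_of_int_eisenstein_iff by (metis of_int_of_nat_eq)
  then have "\<pi> dvd of_int (b * b' - 1)"
    using pi dvd_trans by blast
  \<comment> \<open>Since b' inverts b, the congruence a + b omega = 0 can be solved for omega,
    giving the integer -a b'.\<close>
  then have "\<pi> dvd of_int b' * \<pi> - of_int (b * b' - 1) * omega"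
    by (intro dvd_diff) simp_all
  then have omega: "\<pi> dvd omega + of_int (a * b')"
    by (simp add: \<pi> algebra_simps)
  have rep: "\<exists>l. \<pi> dvd z - of_int l" for z
  proof
    have "\<pi> dvd of_int (omega_part z) * (omega + of_int (a * b'))"
      using omega by simp
    also have "of_int (omega_part z) * (omega + of_int (a * b'))
        = z - of_int (int_part z - omega_part z * (a * b'))"
      by (simp add: of_int_eisenstein omega_def eisenstein_defs)
    finally show "\<pi> dvd z - of_int (int_part z - omega_part z * (a * b'))" .
  qed
  obtain k l where k: "\<pi> dvd x - of_int k" and l: "\<pi> dvd y - of_int l"
    using rep by metis
  have "\<pi> dvd x * y - ((x - of_int k) * y + of_int k * (y - of_int l))"
    using xy k l by (intro dvd_diff dvd_add) simp_all
  then have "\<pi> dvd of_int (k * l)"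
    by (simp add: algebra_simps)
  then have "p dvd eis_norm (of_int (k * l))"
    using eis_norm_dvd norm by blast
  then have "int p dvd int (eis_norm (of_int (k * l)))"
    by simp
  then have "int p dvd (k * l)\<^sup>2"
    by (simp only: int_eis_norm of_int_eisenstein) simp
  then have "int p dvd k \<or> int p dvd l"
    using pp by (simp add: prime_dvd_power_iff prime_dvd_mult_iff)
  then have "\<pi> dvd of_int k \<or> \<pi> dvd of_int l"
    using pi of_int_dvd_of_int_eisenstein_iff dvd_trans by (metis of_int_of_nat_eq)
  then show "\<pi> dvd x \<or> \<pi> dvd y"
    using k l by (metis diff_add_cancel dvd_add)
qed

text \<open>A primitive root raised to the power (p - 1)/3, which is \<open>p div 3\<close> here, is
  a cube root of 1 other than 1; cancelling u - 1 from u^3 - 1 leaves the quadratic.\<close>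

lemma exists_root_of_omega_polynomial:
  assumes "prime p" "p mod 3 = 1"
  obtains u :: int where "int p dvd u\<^sup>2 + u + 1"
proof -
  obtain g where g: "ord p g = p - 1"
    using residue_prime_has_primroot [OF assms(1)] by blast
  define u where "u = g ^ (p div 3)"
  have p: "p - 1 = 3 * (p div 3)" "p > 1"
    using assms(2) mult_div_mod_eq [of 3 p] prime_gt_1_nat [OF assms(1)] by simp_all
  have "[u ^ 3 = 1] (mod p)"
    using ord [of g p] unfolding g p(1) by (simp add: u_def mult.commute flip: power_mult)
  moreover have "[u \<noteq> 1] (mod p)"
  proof
    assume "[u = 1] (mod p)"
    then have "ord p g dvd p div 3"
      by (metis u_def ord_divides)
    then have "p - 1 \<le> p div 3"
      using p g by (intro dvd_imp_le) auto
    then show False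
      using p by linarith
  qed
  ultimately have 1: "int p dvd int u ^ 3 - 1" and 2: "\<not> int p dvd int u - 1"
    by (metis cong_iff_dvd_diff cong_int_iff of_nat_1 of_nat_power)+
  have "int u ^ 3 - 1 = (int u - 1) * ((int u)\<^sup>2 + int u + 1)"
    by (simp add: power2_eq_square power3_eq_cube algebra_simps)
  then have "int p dvd (int u)\<^sup>2 + int u + 1"
    using 1 2 assms(1) by (metis prime_dvd_mult_iff prime_nat_int_transfer)
  then show thesis
    by (rule that)
qed

text \<open>Pigeonhole: with m the integer square root of p there are (m + 1)^2 > p pairs (a, b), so
  two of them give the same residue a - u b. Their difference is the small solution.\<close>

lemma thue:
  fixes p :: nat
  assumes "p > 0"
  obtains x y :: int
  where "int p dvd x - u * y" "x\<^sup>2 \<le> int p" "y\<^sup>2 \<le> int p" "(x, y) \<noteq> (0, 0)"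
proof -
  define m where "m = floor_sqrt p"
  define f where "f = (\<lambda>(a, b). (int a - u * int b) mod int p)"
  have "\<not> inj_on f ({..m} \<times> {..m})"
  proof
    assume "inj_on f ({..m} \<times> {..m})"
    moreover have "f ` ({..m} \<times> {..m}) \<subseteq> {0..<int p}"
      using assms by (auto simp: f_def)
    ultimately have "card ({..m} \<times> {..m}) \<le> card {0..<int p}"
      by (intro card_inj_on_le) simp_all
    then have "(Suc m)\<^sup>2 \<le> p"
      by (simp add: power2_eq_square)
    then show False
      using Suc_floor_sqrt_power2_gt [of p] by (simp add: m_def)
  qed
  then obtain a b a' b' where ab: "a \<le> m" "b \<le> m" "a' \<le> m" "b' \<le> m" "(a, b) \<noteq> (a', b')"
    and eq: "f (a, b) = f (a', b')"
    by (auto simp: inj_on_def)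
  define x y where "x = int a - int a'" and "y = int b - int b'"
  have "int p dvd x - u * y"
    using eq by (simp add: f_def x_def y_def mod_eq_dvd_iff algebra_simps)
  moreover have small: "z\<^sup>2 \<le> int p" if "\<bar>z\<bar> \<le> int m" for z :: int
  proof -
    have "z\<^sup>2 \<le> (int m)\<^sup>2"
      using that by (simp add: abs_le_square_iff [symmetric])
    also have "\<dots> \<le> int p"
      using floor_sqrt_power2_le [of p] by (simp add: m_def flip: of_nat_power)
    finally show ?thesis .
  qed
  moreover have "(x, y) \<noteq> (0, 0)"
    using ab(5) by (simp add: x_def y_def)
  moreover have "\<bar>x\<bar> \<le> int m" "\<bar>y\<bar> \<le> int m"
    using ab by (simp_all add: x_def y_def)
  ultimately show thesis
    using that by blast
qed

text \<open>With x = u y modulo p, the form N = x^2 + x y + y^2 is divisible by p, and the size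
  bounds give 0 < N < 3 p. The value 2 p is impossible: N is even only if x and y both are, and then
  4 divides 2 p.\<close>

lemma split_prime_is_norm:
  assumes p: "prime p" and split: "p mod 3 = 1"
  obtains \<pi> where "eis_norm \<pi> = p"
proof -
  have "p > 0"
    using p by (rule prime_gt_0_nat)
  obtain u where u: "int p dvd u\<^sup>2 + u + 1"
    using exists_root_of_omega_polynomial [OF assms] .
  obtain x y where xy: "int p dvd x - u * y" "x\<^sup>2 \<le> int p" "y\<^sup>2 \<le> int p" "(x, y) \<noteq> (0, 0)"
    using thue [OF \<open>p > 0\<close>] .
  define N where "N = x\<^sup>2 + x * y + y\<^sup>2"
  \<comment> \<open>This makes the bound on x strict, without which N = 3 p could not be ruled
    out.\<close>
  have not_square: "z\<^sup>2 \<noteq> int p" for z :: int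
  proof
    assume "z\<^sup>2 = int p"
    then have "prime (z\<^sup>2)"
      using p by simp
    then show False
      by (simp add: prime_power_iff)
  qed
  have "N = (x - u * y) * (x + u * y + y) + y\<^sup>2 * (u\<^sup>2 + u + 1)"
    by (simp add: N_def power2_eq_square algebra_simps)
  then have "int p dvd N"
    using xy(1) u by simp
  then obtain k where k: "N = int p * k"
    by (elim dvdE)
  have twice: "2 * N = x\<^sup>2 + y\<^sup>2 + (x + y)\<^sup>2" "3 * x\<^sup>2 + 3 * y\<^sup>2 - 2 * N = (x - y)\<^sup>2"
    by (simp_all add: N_def power2_eq_square algebra_simps)
  have "x\<^sup>2 + y\<^sup>2 > 0"
    using xy(4) by (simp add: sum_power2_gt_zero_iff)
  then have "N > 0"
    using twice(1) zero_le_power2 [of "x + y"] by linarith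
  moreover have "N < int p * 3"
    using twice(2) zero_le_power2 [of "x - y"] le_neq_trans [OF xy(2) not_square] xy(3) by linarith
  ultimately have "k = 1 \<or> k = 2"
    using \<open>p > 0\<close> k by (auto simp: zero_less_mult_iff)
  moreover have "k \<noteq> 2"
  proof
    assume "k = 2"
    then have "even N"
      using k by simp
    then have "even x" "even y"
      by (auto simp: N_def)
    then have "4 dvd N"
      by (auto elim!: dvdE simp: N_def power2_eq_square)
    then have "4 dvd int p * 2"
      using k \<open>k = 2\<close> by simp
    then have "2 dvd p"
      by presburger
    then have "p = 2"
      using p primes_dvd_imp_eq two_is_prime_nat by blast
    then show False
      using split by simp
  qed
  \<comment> \<open>The norm of a + b omega contains -a b, hence the minus sign at y.\<close>
  ultimately have "int (eis_norm (Eisenstein x (- y))) = int p"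
    using k by (simp add: int_eis_norm N_def)
  then show thesis
    using that by simp
qed

lemma split_prime_not_prime_elem:
  assumes p: "prime p" and "p mod 3 = 1"
  shows "\<not> prime_elem (of_nat p :: eisenstein)"
proof
  assume prime: "prime_elem (of_nat p :: eisenstein)"
  obtain \<pi> where \<pi>: "eis_norm \<pi> = p"
    using split_prime_is_norm [OF assms] .
  then have "of_nat p dvd \<pi> * eis_cnj \<pi>"
    by (simp add: mult_eis_cnj)
  then have "of_nat p dvd \<pi> \<or> of_nat p dvd eis_cnj \<pi>"
    using prime by (simp add: prime_elem_dvd_mult_iff)
  then have "of_nat p dvd \<pi>"
    using eis_cnj_dvd by (metis eis_cnj_cnj eis_cnj_of_nat)
  then show False
    using of_nat_prime_not_dvd_norm_eq [OF p \<pi>] by blast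
qed

text \<open>The norms of the factors multiply to p^2 and none of them is 1, so there is one factor
  of norm p^2 or there are two of norm p. Because the product is p itself and not merely an
  associate, cancelling the first factor of norm p leaves exactly its conjugate.\<close>

lemma prime_elem_factorization_cases:
  assumes p: "prime p" and F: "\<forall>\<pi>\<in>#F. prime_elem \<pi>" "prod_mset F = of_nat p"
  obtains (inert) "F = {#of_nat p#}"
    | (split) \<pi> where "F = {#\<pi>, eis_cnj \<pi>#}" "eis_norm \<pi> = p"
proof -
  have empty: "G = {#}" if "G \<subseteq># F" "eis_norm (prod_mset G) = 1" for G
  proof (rule ccontr)
    assume "G \<noteq> {#}"
    then obtain \<rho> where \<rho>: "\<rho> \<in># G"
      by blast
    then have "\<rho> dvd prod_mset G"
      by (rule dvd_prod_mset)
    then have "eis_norm \<rho> = 1"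
      using eis_norm_dvd that(2) by (metis nat_dvd_1_iff_1)
    moreover have "prime_elem \<rho>"
      using \<rho> that(1) F(1) by (meson mset_subset_eqD)
    ultimately show False
      using eis_norm_prime_elem_neq_1 by blast
  qed
  have norm: "eis_norm (prod_mset F) = p\<^sup>2"
    by (simp add: F(2))
  have "F \<noteq> {#}"
    using norm p by (auto simp: eis_norm_def one_eisenstein_def dest: sym)
  then obtain \<pi> G where G: "F = add_mset \<pi> G"
    by (meson multiset_cases)
  have pos: "p > 0"
    using p by (rule prime_gt_0_nat)
  have prod: "eis_norm \<pi> * eis_norm (prod_mset G) = p\<^sup>2"
    using norm by (simp add: G eis_norm_mult)
  then have "eis_norm \<pi> dvd p\<^sup>2"
    by (metis dvd_triv_left)
  then obtain i where i: "i \<le> 2" "eis_norm \<pi> = p ^ i"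
    using p by (auto simp: divides_primepow_nat)
  moreover have "eis_norm \<pi> \<noteq> 1"
    using F(1) eis_norm_prime_elem_neq_1 [of \<pi>] by (simp add: G)
  ultimately have "i \<noteq> 0"
    by (intro notI) simp
  then have "i = 1 \<or> i = 2"
    using i(1) by linarith
  then consider "eis_norm \<pi> = p" | "eis_norm \<pi> = p\<^sup>2"
    using i(2) by auto
  then show thesis
  proof cases
    case 1
    have "\<pi> * prod_mset G = \<pi> * eis_cnj \<pi>"
      using F(2) 1 by (simp add: G mult_eis_cnj)
    moreover have "\<pi> \<noteq> 0"
      using F(1) by (auto simp: G)
    ultimately have prod_G: "prod_mset G = eis_cnj \<pi>"
      by simp
    have norm_G: "eis_norm (prod_mset G) = p"
      using prod 1 pos by (simp add: power2_eq_square)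
    then have "G \<noteq> {#}"
      using p by (auto simp: eis_norm_def one_eisenstein_def)
    then obtain \<rho> H where H: "G = add_mset \<rho> H"
      by (meson multiset_cases)
    have prod_H: "eis_norm \<rho> * eis_norm (prod_mset H) = p"
      using norm_G by (simp add: H eis_norm_mult)
    moreover have "eis_norm \<rho> \<noteq> 1"
      using F(1) eis_norm_prime_elem_neq_1 [of \<rho>] by (simp add: G H)
    ultimately have "eis_norm \<rho> = p"
      using p by (metis dvd_triv_left prime_nat_iff)
    then have "eis_norm (prod_mset H) = 1"
      using prod_H pos by simp
    then have "H = {#}"
      by (intro empty) (simp_all add: G H)
    then have "F = {#\<pi>, eis_cnj \<pi>#}"
      using prod_G by (simp add: G H)
    then show thesis
      using 1 split by blast
  next
    case 2
    then have "G = {#}"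
      using prod pos by (intro empty) (simp_all add: G)
    then show thesis
      using F(2) G inert by simp
  qed
qed

section \<open>Evaluation of the cubic Jacobi symbol\<close>

lemma cubic_residue_symbol_unique:
  assumes "\<not> eis_norm \<pi> dvd 3" "y \<in> cube_roots" "z \<in> cube_roots"
    and "\<pi> dvd x - y" "\<pi> dvd x - z"
  shows "y = z"
proof (rule ccontr)
  assume "y \<noteq> z"
  have "\<pi> dvd (x - z) - (x - y)"
    using assms(4,5) by (rule dvd_diff [rotated])
  then have "eis_norm \<pi> dvd eis_norm (y - z)"
    by (intro eis_norm_dvd) simp
  then show False
    using cube_roots_norm_diff [OF assms(2,3) \<open>y \<noteq> z\<close>] assms(1) by simp
qed

text \<open>Fermat's theorem for the residue field is taken as a hypothesis, so that split and inert
  primes can each supply their own Frobenius congruence. It makes the prime divide the cube of the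
  power minus 1, hence one of three linear factors.\<close>

lemma cubic_residue_symbol:
  assumes prime: "prime_elem \<pi>" and norm: "3 dvd eis_norm \<pi> - 1" "\<not> eis_norm \<pi> dvd 3" "eis_norm \<pi> > 0"
    and \<alpha>: "\<pi> dvd \<alpha> ^ eis_norm \<pi> - \<alpha>" "\<not> \<pi> dvd \<alpha>"
  shows "cubic_residue_symbol \<alpha> \<pi> \<in> cube_roots"
    and "\<pi> dvd \<alpha> ^ ((eis_norm \<pi> - 1) div 3) - cubic_residue_symbol \<alpha> \<pi>"
proof -
  define k where "k = (eis_norm \<pi> - 1) div 3"
  have k: "eis_norm \<pi> = Suc (k * 3)"
    using norm(1,3) by (simp add: k_def)
  have "\<alpha> ^ eis_norm \<pi> - \<alpha> = \<alpha> * ((\<alpha> ^ k) ^ 3 - 1)"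
    unfolding k by (simp add: algebra_simps power_mult)
  then have "\<pi> dvd (\<alpha> ^ k) ^ 3 - 1"
    using \<alpha> prime prime_elem_dvd_mult_iff by metis
  then have "\<exists>z\<in>cube_roots. \<pi> dvd \<alpha> ^ k - z"
    using prime by (simp add: cube_roots_def prime_elem_dvd_mult_iff
        flip: cube_minus_one_factorization)
  then have "\<exists>!z. z \<in> cube_roots \<and> \<pi> dvd \<alpha> ^ k - z"
    using cubic_residue_symbol_unique [OF norm(2)] by blast
  from theI' [OF this]
  show "cubic_residue_symbol \<alpha> \<pi> \<in> cube_roots"
    and "\<pi> dvd \<alpha> ^ ((eis_norm \<pi> - 1) div 3) - cubic_residue_symbol \<alpha> \<pi>"
    by (simp_all add: cubic_residue_symbol_def cube_roots_def k_def)
qed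

text \<open>The square in the following relation makes it independent of how a split prime is
  factored: a congruence that holds modulo each of two prime factors of \<open>p\<close> holds modulo \<open>p\<close>
  after squaring, so that neither coprimality of the factors nor unique factorization is needed.\<close>

definition jacobi_relation :: "nat \<Rightarrow> eisenstein \<Rightarrow> eisenstein \<Rightarrow> bool" where
  "jacobi_relation p \<alpha> z \<longleftrightarrow> z \<in> cube_roots \<and>
     of_nat p dvd (if p mod 3 = 1 then \<alpha> ^ (p div 3) - z * eis_cnj \<alpha> ^ (p div 3)
                   else eis_cnj \<alpha> ^ Suc (p div 3) - z * \<alpha> ^ Suc (p div 3))\<^sup>2"

lemma eis_norm_cnj [simp]: "eis_norm (eis_cnj x) = eis_norm x"
  by (simp add: eis_norm_def eis_cnj_def power2_eq_square algebra_simps)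

text \<open>Each monomial of the expanded cube contains x^2 or y^2. This compensates for the square
  in \<open>jacobi_relation\<close> when two solutions are compared.\<close>

lemma dvd_square_cube_diff:
  fixes x y :: "'a :: comm_ring_1"
  assumes "a dvd x\<^sup>2" "a dvd y\<^sup>2"
  shows "a dvd (x - y) ^ 3"
proof -
  have "(x - y) ^ 3 = x\<^sup>2 * (x - 3 * y) + y\<^sup>2 * (3 * x - y)"
    by (simp add: power2_eq_square power3_eq_cube algebra_simps)
  then show ?thesis
    using assms by simp
qed

text \<open>The cube of (y - z) Y is divisible by p, and its norm is (3 N(Y))^3, which p does not
  divide.\<close>

lemma scaled_cube_root_unique:
  assumes p: "prime p" "p > 3" and Y: "\<not> p dvd eis_norm Y"
    and yz: "y \<in> cube_roots" "z \<in> cube_roots"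
    and dvd: "of_nat p dvd (X - y * Y)\<^sup>2" "of_nat p dvd (X - z * Y)\<^sup>2"
  shows "y = z"
proof (rule ccontr)
  assume "y \<noteq> z"
  have "of_nat p dvd ((X - z * Y) - (X - y * Y)) ^ 3"
    by (intro dvd_square_cube_diff dvd)
  also have "(X - z * Y) - (X - y * Y) = (y - z) * Y"
    by (simp add: algebra_simps)
  finally have "p\<^sup>2 dvd eis_norm (((y - z) * Y) ^ 3)"
    using eis_norm_dvd eis_norm_of_nat by metis
  then have "p dvd (3 * eis_norm Y) ^ 3"
    using cube_roots_norm_diff [OF yz \<open>y \<noteq> z\<close>]
    by (simp add: eis_norm_mult eis_norm_power dvd_mult_left power2_eq_square)
  then have "p dvd 3 * eis_norm Y"
    using p(1) by (rule prime_dvd_power [rotated])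
  then have "p dvd 3"
    using p(1) Y by (simp add: prime_dvd_mult_iff)
  then show False
    using p(2) by (auto dest: dvd_imp_le)
qed

lemma jacobi_relation_unique:
  assumes "prime p" "p > 3" "\<not> p dvd eis_norm \<alpha>" "jacobi_relation p \<alpha> y" "jacobi_relation p \<alpha> z"
  shows "y = z"
proof -
  have Y: "\<not> p dvd eis_norm (eis_cnj \<alpha> ^ k)" "\<not> p dvd eis_norm (\<alpha> ^ k)" for k
    using prime_dvd_power [OF assms(1)] assms(3) by (auto simp: eis_norm_power)
  show ?thesis
  proof (cases "p mod 3 = 1")
    case True
    show ?thesis
      by (rule scaled_cube_root_unique
          [OF assms(1,2) Y(1) [of "p div 3"], where X = "\<alpha> ^ (p div 3)"])
        (use assms(4,5) True in \<open>simp_all add: jacobi_relation_def\<close>)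
  next
    case False
    show ?thesis
      by (rule scaled_cube_root_unique
          [OF assms(1,2) Y(2) [of "Suc (p div 3)"], where X = "eis_cnj \<alpha> ^ Suc (p div 3)"])
        (use assms(4,5) False in \<open>simp_all add: jacobi_relation_def del: power_Suc\<close>)
  qed
qed

lemma prime_mod_3:
  assumes "prime (p :: nat)" "p > 3"
  shows "p mod 3 = 1 \<or> p mod 3 = 2"
proof -
  have "\<not> 3 dvd p"
    using assms primes_dvd_imp_eq [of 3 p] by auto
  then show ?thesis
    by presburger
qed

text \<open>Let s and t be the two symbols, X and Y the powers of alpha and of its conjugate. Modulo
  pi, X is s, and conjugating the congruence at the other factor shows that Y is the inverse of t;
  so X is s t Y. The other factor is symmetric.\<close>

lemma jacobi_relation_split:
  assumes p: "prime p" "p > 3" "p mod 3 = 1" and \<alpha>: "\<not> p dvd eis_norm \<alpha>" and \<pi>: "eis_norm \<pi> = p"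
  shows "jacobi_relation p \<alpha>
    (cubic_residue_symbol \<alpha> \<pi> * cubic_residue_symbol \<alpha> (eis_cnj \<pi>))"
proof -
  have norm: "3 dvd p - 1" "(p - 1) div 3 = p div 3" "\<not> p dvd 3" "p > 0"
    using p by (auto dest: dvd_imp_le) presburger+
  have symbol: "cubic_residue_symbol \<alpha> \<rho> \<in> cube_roots"
    "\<rho> dvd \<alpha> ^ (p div 3) - cubic_residue_symbol \<alpha> \<rho>" if \<rho>: "eis_norm \<rho> = p" for \<rho>
  proof -
    have "prime_elem \<rho>"
      using p(1) \<rho> by (rule prime_elem_norm_prime)
    moreover have "\<rho> dvd \<alpha> ^ p - \<alpha>"
      using norm_prime_imp_dvd [OF \<rho>] split_prime_dvd_power_diff [OF p(1,3)] by (rule dvd_trans)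
    moreover have "\<not> \<rho> dvd \<alpha>"
      using eis_norm_dvd \<alpha> \<rho> by blast
    ultimately show "cubic_residue_symbol \<alpha> \<rho> \<in> cube_roots"
      "\<rho> dvd \<alpha> ^ (p div 3) - cubic_residue_symbol \<alpha> \<rho>"
      using cubic_residue_symbol [of \<rho> \<alpha>] norm \<rho> by simp_all
  qed
  define X Y where "X = \<alpha> ^ (p div 3)" and "Y = eis_cnj \<alpha> ^ (p div 3)"
  define s t where "s = cubic_residue_symbol \<alpha> \<pi>" and "t = cubic_residue_symbol \<alpha> (eis_cnj \<pi>)"
  have s: "s \<in> cube_roots" "\<pi> dvd X - s" and t: "t \<in> cube_roots" "eis_cnj \<pi> dvd X - t"
    using symbol \<pi> by (simp_all add: s_def t_def X_def)
  have st: "eis_cnj \<pi> dvd Y - eis_cnj s" "\<pi> dvd Y - eis_cnj t"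
    using eis_cnj_dvd [OF s(2)] eis_cnj_dvd [OF t(2)] by (simp_all add: X_def Y_def)
  have eq: "X - y * z * Y = (X - y) - y * z * (Y - eis_cnj z)" if "z \<in> cube_roots" for y z
  proof -
    have "y * z * (Y - eis_cnj z) = y * z * Y - y * (z * eis_cnj z)"
      by (simp add: algebra_simps)
    then show ?thesis
      using cube_roots_cnj [OF that] by simp
  qed
  have "\<pi> dvd X - s * t * Y"
    unfolding eq [OF t(1)] by (rule dvd_diff [OF s(2) dvd_mult [OF st(2)]])
  moreover have "eis_cnj \<pi> dvd X - t * s * Y"
    unfolding eq [OF s(1)] by (rule dvd_diff [OF t(2) dvd_mult [OF st(1)]])
  then have "eis_cnj \<pi> dvd X - s * t * Y"
    by (simp only: mult.commute [of t s])
  ultimately have "\<pi> * eis_cnj \<pi> dvd (X - s * t * Y)\<^sup>2"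
    unfolding power2_eq_square by (rule mult_dvd_mono)
  then show ?thesis
    using p(3) s(1) t(1)
    by (simp add: jacobi_relation_def cube_roots_mult mult_eis_cnj \<pi> flip: s_def t_def X_def Y_def)
qed

lemma jacobi_relation_inert:
  assumes p: "prime p" "p > 3" "p mod 3 = 2" and \<alpha>: "\<not> p dvd eis_norm \<alpha>"
  shows "jacobi_relation p \<alpha> (cubic_residue_symbol \<alpha> (of_nat p))"
proof -
  define n where "n = p div 3"
  have n: "p = 3 * n + 2"
    using p(3) mult_div_mod_eq [of 3 p] by (simp add: n_def)
  \<comment> \<open>Since p + 1 = 3 (n + 1), the symbol at p has exponent (p - 1)(n + 1). One more
    factor alpha^(n+1) completes this to (alpha^p)^(n+1), to which Frobenius applies.\<close>
  have p2: "p\<^sup>2 - 1 = 3 * ((p - 1) * Suc n)"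
    by (simp add: n power2_eq_square algebra_simps)
  have "p\<^sup>2 > 3"
    using p(2) self_le_power [of p 2] by linarith
  then have "\<not> p\<^sup>2 dvd 3"
    by (auto dest: dvd_imp_le)
  moreover have "\<not> of_nat p dvd \<alpha>"
    using \<alpha> eis_norm_dvd [of "of_nat p" \<alpha>] by (auto simp: power2_eq_square dest: dvd_mult_left)
  ultimately have symbol: "cubic_residue_symbol \<alpha> (of_nat p) \<in> cube_roots"
    "of_nat p dvd \<alpha> ^ ((p - 1) * Suc n) - cubic_residue_symbol \<alpha> (of_nat p)"
    using cubic_residue_symbol [OF inert_prime_elem [OF p(1,3)], of \<alpha>]
      inert_prime_dvd_power_diff [OF p(1,3), of \<alpha>] p(2) by (simp_all only: eis_norm_of_nat p2) simp_all
  define s where "s = cubic_residue_symbol \<alpha> (of_nat p)"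
  have "of_nat p dvd (\<alpha> ^ p) ^ Suc n - eis_cnj \<alpha> ^ Suc n"
    by (intro dvd_power_diff inert_prime_dvd_power_diff_cnj p)
  moreover have "of_nat p dvd \<alpha> ^ Suc n * (\<alpha> ^ ((p - 1) * Suc n) - s)"
    using symbol(2) unfolding s_def by (rule dvd_mult)
  ultimately have "of_nat p dvd \<alpha> ^ Suc n * (\<alpha> ^ ((p - 1) * Suc n) - s)
      - ((\<alpha> ^ p) ^ Suc n - eis_cnj \<alpha> ^ Suc n)"
    by (rule dvd_diff [rotated])
  moreover have "\<alpha> ^ Suc n * \<alpha> ^ ((p - 1) * Suc n) = (\<alpha> ^ p) ^ Suc n"
    unfolding power_mult [symmetric] power_add [symmetric] by (simp add: n algebra_simps)
  ultimately have "of_nat p dvd eis_cnj \<alpha> ^ Suc n - s * \<alpha> ^ Suc n"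
    by (simp add: right_diff_distrib mult.commute del: power_Suc)
  then show ?thesis
    using symbol(1) p(3)
    by (simp add: jacobi_relation_def n_def s_def power2_eq_square del: power_Suc)
qed

text \<open>Every factorization yields a solution of the relation, and the relation has only one;
  this is what makes the definite description well defined.\<close>

lemma jacobi_relation_cubic_jacobi:
  assumes p: "prime p" "p > 3" and \<alpha>: "\<not> p dvd eis_norm \<alpha>"
  shows "jacobi_relation p \<alpha> (cubic_jacobi \<alpha> p)"
proof -
  let ?P = "\<lambda>z. \<exists>F. (\<forall>\<pi>\<in>#F. prime_elem \<pi>) \<and> prod_mset F = of_nat p \<and>
    z = (\<Prod>\<pi>\<in>#F. cubic_residue_symbol \<alpha> \<pi>)"
  have relation: "jacobi_relation p \<alpha> z" if "?P z" for z
  proof -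
    from that obtain F where F: "\<forall>\<pi>\<in>#F. prime_elem \<pi>" "prod_mset F = of_nat p"
      and z: "z = (\<Prod>\<pi>\<in>#F. cubic_residue_symbol \<alpha> \<pi>)"
      by blast
    from p(1) F show ?thesis
    proof (cases rule: prime_elem_factorization_cases)
      case inert
      then have "prime_elem (of_nat p :: eisenstein)"
        using F(1) by simp
      then have "p mod 3 = 2"
        using split_prime_not_prime_elem [OF p(1)] prime_mod_3 [OF p] by blast
      then show ?thesis
        using jacobi_relation_inert [OF p _ \<alpha>] by (simp add: z inert)
    next
      case (split \<pi>)
      have "\<not> of_nat p dvd \<pi>"
        using p(1) split(2) by (rule of_nat_prime_not_dvd_norm_eq)
      then have "p mod 3 = 1"
        using prime_mod_3 [OF p] inert_prime_dvd_norm_imp_dvd [OF p(1), of \<pi>] split(2) by auto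
      then show ?thesis
        using jacobi_relation_split [OF p _ \<alpha> split(2)] by (simp add: z split)
    qed
  qed
  have "\<exists>z. ?P z"
  proof (cases "p mod 3 = 1")
    case True
    then obtain \<pi> where \<pi>: "eis_norm \<pi> = p"
      using split_prime_is_norm p(1) by blast
    then show ?thesis
      using p(1) by (intro exI [where x = "prod_mset (image_mset (cubic_residue_symbol \<alpha>) {#\<pi>, eis_cnj \<pi>#})"]
          exI [of _ "{#\<pi>, eis_cnj \<pi>#}"])
        (simp add: mult_eis_cnj prime_elem_norm_prime)
  next
    case False
    then show ?thesis
      using p prime_mod_3 [OF p] by (intro exI [where x = "prod_mset (image_mset (cubic_residue_symbol \<alpha>) {#of_nat p#})"]
          exI [of _ "{#of_nat p#}"])
        (simp add: inert_prime_elem)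
  qed
  then have "\<exists>!z. ?P z"
    by (rule ex_ex1I) (rule jacobi_relation_unique [OF p \<alpha> relation relation])
  then show ?thesis
    unfolding cubic_jacobi_def by (rule relation [OF theI'])
qed

text \<open>Every factor in a factorization divides p, so it divides the same differences for both
  arguments. The descriptions thus have equivalent predicates and agree even where the symbols are
  not meaningful.\<close>

lemma cubic_jacobi_cong:
  assumes "of_nat p dvd \<alpha> - \<beta>"
  shows "cubic_jacobi \<alpha> p = cubic_jacobi \<beta> p"
proof -
  have symbol: "cubic_residue_symbol \<alpha> \<pi> = cubic_residue_symbol \<beta> \<pi>" if "\<pi> dvd of_nat p" for \<pi>
  proof -
    have "\<pi> dvd \<alpha> ^ k - \<beta> ^ k" for k
      using that assms by (intro dvd_power_diff) (rule dvd_trans)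
    moreover have "\<alpha> ^ k - z = (\<alpha> ^ k - \<beta> ^ k) + (\<beta> ^ k - z)" for k z
      by simp
    ultimately have "\<pi> dvd \<alpha> ^ k - z \<longleftrightarrow> \<pi> dvd \<beta> ^ k - z" for k z
      by (metis dvd_add_right_iff)
    then show ?thesis
      unfolding cubic_residue_symbol_def by simp
  qed
  have prod: "(\<Prod>\<pi>\<in>#F. cubic_residue_symbol \<alpha> \<pi>) = (\<Prod>\<pi>\<in>#F. cubic_residue_symbol \<beta> \<pi>)"
    if "prod_mset F = of_nat p" for F
    using that symbol by (intro arg_cong [of _ _ prod_mset] image_mset_cong) (metis dvd_prod_mset)
  then show ?thesis
    unfolding cubic_jacobi_def by (simp add: prod cong: conj_cong)
qed

section \<open>Binomial sums\<close>

lemma binomial_sum_power_sum: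
  fixes a b :: "'a :: comm_ring_1"
  shows "(a + b) * (\<Sum>k\<le>n. of_nat ((n + k) choose (2 * k)) * ((a - b)\<^sup>2) ^ k * (a * b) ^ (n - k))
    = a ^ (2 * n + 1) + b ^ (2 * n + 1)"
proof -
  define y u where "y = (a - b)\<^sup>2" and "u = a * b"
  define f where "f n = (\<Sum>k\<le>n. of_nat ((n + k) choose (2 * k)) * y ^ k * u ^ (n - k))" for n
  \<comment> \<open>The companion with odd lower index: Pascal's rule couples it to
    \<open>f\<close>, so the induction must carry both.\<close>
  define g where "g n = (\<Sum>k\<le>n. of_nat (Suc (n + k) choose Suc (2 * k)) * y ^ k * u ^ (n - k))" for n
  have f_Suc: "f (Suc n) = u * f n + y * g n" for n
  proof -
    have "f (Suc n) = u ^ Suc n +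
        (\<Sum>k\<le>n. of_nat (Suc (Suc (n + k)) choose Suc (Suc (2 * k))) * y ^ Suc k * u ^ (n - k))"
      unfolding f_def by (subst sum.atMost_Suc_shift) simp
    also have "\<dots> = (u ^ Suc n +
        (\<Sum>k\<le>n. of_nat (Suc (n + k) choose Suc (Suc (2 * k))) * y ^ Suc k * u ^ (n - k))) + y * g n"
      unfolding g_def sum_distrib_left binomial_Suc_Suc [of "Suc (n + _)" "Suc _"] of_nat_add
      by (simp add: distrib_right sum.distrib algebra_simps del: binomial_Suc_Suc)
    also have "u ^ Suc n +
        (\<Sum>k\<le>n. of_nat (Suc (n + k) choose Suc (Suc (2 * k))) * y ^ Suc k * u ^ (n - k))
        = (\<Sum>k\<le>Suc n. of_nat ((n + k) choose (2 * k)) * y ^ k * u ^ (Suc n - k))"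
      by (subst sum.atMost_Suc_shift) (simp del: binomial_Suc_Suc)
    \<comment> \<open>The extra term k = n + 1 is zero, its lower index 2n + 2 exceeding 2n +
      1.\<close>
    also have "\<dots> = u * f n"
      unfolding f_def sum_distrib_left
      by (simp add: Suc_diff_le binomial_eq_0 mult_ac del: binomial_Suc_Suc)
    finally show ?thesis .
  qed
  have g_Suc: "g (Suc n) = u * g n + f (Suc n)" for n
  proof -
    have Pascal: "Suc (Suc n + k) choose Suc (2 * k)
        = (Suc (n + k) choose Suc (2 * k)) + ((Suc n + k) choose (2 * k))" for k
      by simp
    have "g (Suc n) = (\<Sum>k\<le>Suc n. of_nat (Suc (n + k) choose Suc (2 * k)) * y ^ k * u ^ (Suc n - k))
        + f (Suc n)"
      by (simp only: g_def f_def Pascal of_nat_add distrib_right sum.distrib)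
    also have "(\<Sum>k\<le>Suc n. of_nat (Suc (n + k) choose Suc (2 * k)) * y ^ k * u ^ (Suc n - k)) = u * g n"
      unfolding g_def sum_distrib_left
      by (simp add: Suc_diff_le binomial_eq_0 mult_ac del: binomial_Suc_Suc)
    finally show ?thesis .
  qed
  \<comment> \<open>\<open>g n\<close> stands for the quotient of a^(2n+2) - b^(2n+2) by a^2 - b^2;
    the ring has no division, so both closed forms are stated multiplied out.\<close>
  have "(a + b) * f n = a ^ (2 * n + 1) + b ^ (2 * n + 1) \<and>
      (a - b) * ((a + b) * g n) = a ^ (2 * n + 2) - b ^ (2 * n + 2)" for n
  proof (induction n)
    case 0
    show ?case
      by (simp add: f_def g_def power2_eq_square algebra_simps)
  next
    case (Suc n)
    have "(a + b) * f (Suc n) = u * ((a + b) * f n) + (a - b) * ((a - b) * ((a + b) * g n))"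
      by (simp add: f_Suc y_def power2_eq_square algebra_simps)
    also have "\<dots> = a ^ (2 * Suc n + 1) + b ^ (2 * Suc n + 1)"
      unfolding Suc.IH [THEN conjunct1] Suc.IH [THEN conjunct2] u_def by (simp add: algebra_simps)
    finally have f: "(a + b) * f (Suc n) = a ^ (2 * Suc n + 1) + b ^ (2 * Suc n + 1)" .
    have "(a - b) * ((a + b) * g (Suc n))
        = u * ((a - b) * ((a + b) * g n)) + (a - b) * ((a + b) * f (Suc n))"
      unfolding g_Suc by (simp add: algebra_simps)
    also have "\<dots> = a ^ (2 * Suc n + 2) - b ^ (2 * Suc n + 2)"
      unfolding Suc.IH [THEN conjunct2] f u_def by (simp add: algebra_simps)
    finally show ?case
      using f by blast
  qed
  then show ?thesis
    by (simp add: f_def y_def u_def)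
qed

text \<open>The ratio of consecutive coefficients, cleared of denominators. The factor on the left
  is the one in \<open>binomial_add_Suc\<close>, so the two recurrences can be compared term by
  term.\<close>

lemma binomial_triple_Suc:
  "2 * (k + 1) * (2 * k + 1) * ((3 * Suc k) choose Suc k)
    = 3 * (3 * k + 1) * (3 * k + 2) * ((3 * k) choose k)"
proof -
  define B B' where "B = (3 * k) choose k" and "B' = (3 * Suc k) choose Suc k"
  have B: "fact k * fact (2 * k) * B = (fact (3 * k) :: nat)"
    using binomial_fact_lemma [of k "3 * k"] by (simp add: B_def)
  have "fact (Suc k) * fact (2 * k + 2) * B' = (fact (3 * k + 3) :: nat)"
    using binomial_fact_lemma [of "Suc k" "3 * Suc k"] by (simp add: B'_def add.commute)
  then have "(fact k * fact (2 * k) * (k + 1)) * (2 * (k + 1) * (2 * k + 1) * B')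
      = (3 * (k + 1)) * (3 * k + 1) * (3 * k + 2) * fact (3 * k)"
    by (simp add: numeral_2_eq_2 numeral_3_eq_3 algebra_simps)
  also have "\<dots> = (fact k * fact (2 * k) * (k + 1)) * (3 * (3 * k + 1) * (3 * k + 2) * B)"
    unfolding B [symmetric] by (simp only: mult_ac)
  finally show ?thesis
    by (simp only: B_def B'_def mult_cancel_left) simp
qed

lemma binomial_add_Suc:
  assumes "k < n"
  shows "2 * (k + 1) * (2 * k + 1) * ((n + Suc k) choose (2 * Suc k))
    = (n + k + 1) * (n - k) * ((n + k) choose (2 * k))"
proof -
  obtain d where n: "n = k + Suc d"
    using assms less_iff_Suc_add by auto
  define B B' where "B = (n + k) choose (2 * k)" and "B' = (n + Suc k) choose (2 * Suc k)"
  have B: "fact (2 * k) * fact (Suc d) * B = (fact (n + k) :: nat)"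
    using binomial_fact_lemma [of "2 * k" "n + k"] by (simp add: B_def n)
  have "fact (2 * k + 2) * fact d * B' = (fact (Suc (n + k)) :: nat)"
    using binomial_fact_lemma [of "2 * Suc k" "n + Suc k"] by (simp add: B'_def n)
  then have "(fact (2 * k) * fact d) * (2 * (k + 1) * (2 * k + 1) * B') = (n + k + 1) * fact (n + k)"
    by (simp add: numeral_2_eq_2 algebra_simps)
  also have "\<dots> = (fact (2 * k) * fact d) * ((n + k + 1) * Suc d * B)"
    by (simp only: B [symmetric] fact_Suc of_nat_id mult_ac)
  finally show ?thesis
    by (simp only: B_def B'_def mult_cancel_left) (simp add: n)
qed

text \<open>Modulo \<open>p\<close>, the numbers \<open>- [p/3]\<close> and \<open>[p/3] + 1\<close> are \<open>1/3\<close> and \<open>2/3\<close> in some order, and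
  the two coefficients are those of the hypergeometric series with these parameters.\<close>

lemma binomial_triple_cong:
  assumes p: "prime p" "p > 3" and "k \<le> p div 3"
  shows "int p dvd int ((3 * k) choose k) - int ((p div 3 + k) choose (2 * k)) * (- 27) ^ k"
  using assms(3)
proof (induction k)
  case (Suc k)
  define n where "n = p div 3"
  have k: "k < n"
    using Suc.prems by (simp add: n_def)
  define A B A' B' where "A = int ((3 * k) choose k)" and "B = int ((n + k) choose (2 * k))"
    and "A' = int ((3 * Suc k) choose Suc k)" and "B' = int ((n + Suc k) choose (2 * Suc k))"
  define N K where "N = int n" and "K = int k"
  define c where "c = 2 * (K + 1) * (2 * K + 1)"
  have A': "c * A' = 3 * (3 * K + 1) * (3 * K + 2) * A"
    using arg_cong [OF binomial_triple_Suc [of k], of int]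
    unfolding c_def A_def A'_def K_def by (simp only: of_nat_mult of_nat_add of_nat_numeral of_nat_1)
  have B': "c * B' = (N + K + 1) * (N - K) * B"
    using arg_cong [OF binomial_add_Suc [OF k], of int] k
    unfolding c_def B_def B'_def K_def N_def
    by (simp only: of_nat_mult of_nat_add of_nat_numeral of_nat_1 of_nat_diff less_imp_le)
  obtain e where e: "e = 1 \<or> e = 2" "3 * N = int p - e"
  proof -
    have "3 * N = int p - int (p mod 3)"
      by (simp add: N_def n_def zdiv_int zmod_int minus_mod_eq_mult_div)
    then show thesis
      using prime_mod_3 [OF p] that [of "int (p mod 3)"] by auto
  qed
  have "9 * ((N + K + 1) * (N - K)) = (3 * N + 3 * K + 3) * (3 * N - 3 * K)"
    by (simp add: algebra_simps)
  \<comment> \<open>Modulo p, 3 N is -e, so the nine-fold product becomes -(3K + e)(3K + 3 - e),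
    which is -(3K + 1)(3K + 2) for either e. Hence the two recurrences differ exactly by the ratio
    -27.\<close>
  then have "(3 * K + 1) * (3 * K + 2) + 9 * ((N + K + 1) * (N - K)) = int p * (int p + 3 - 2 * e)"
    using e(1) unfolding e(2) by (auto simp: algebra_simps)
  moreover have "c * (A' - B' * (- 27) ^ Suc k) = c * A' + 27 * (- 27) ^ k * (c * B')"
    by (simp add: algebra_simps)
  then have "c * (A' - B' * (- 27) ^ Suc k) = 3 * (3 * K + 1) * (3 * K + 2) * (A - B * (- 27) ^ k)
      + 3 * B * (- 27) ^ k * ((3 * K + 1) * (3 * K + 2) + 9 * ((N + K + 1) * (N - K)))"
    unfolding A' B' by (simp add: algebra_simps)
  moreover have "int p dvd A - B * (- 27) ^ k"
    using Suc by (simp add: A_def B_def n_def)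
  ultimately have "int p dvd c * (A' - B' * (- 27) ^ Suc k)"
    by simp
  \<comment> \<open>As k < [p/3], the factors k + 1 and 2k + 1 are positive and smaller than
    p.\<close>
  moreover have "\<not> int p dvd c"
  proof -
    have small: "\<not> p dvd j" if "0 < j" "j < p" for j
      using that by (auto dest: dvd_imp_le)
    have n3: "3 * n \<le> p"
      by (simp add: n_def)
    have "\<not> p dvd 2 \<and> \<not> p dvd k + 1 \<and> \<not> p dvd 2 * k + 1"
      by (insert p(2) k n3, intro conjI small; linarith)
    then have "\<not> p dvd 2 * (k + 1) * (2 * k + 1)"
      by (metis p(1) prime_dvd_mult_iff)
    moreover have "c = int (2 * (k + 1) * (2 * k + 1))"
      by (simp add: c_def K_def algebra_simps)
    ultimately show ?thesis
      by (simp only: of_nat_dvd_iff not_False_eq_True)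
  qed
  ultimately have "int p dvd A' - B' * (- 27) ^ Suc k"
    using p(1) by (metis prime_dvd_mult_iff prime_nat_int_transfer)
  then show ?case
    by (simp only: A'_def B'_def n_def)
qed simp

text \<open>This removes the square of \<open>jacobi_relation\<close> and descends to the integers:
  p divides w^2, which divides l^2.\<close>

lemma prime_dvd_if_square_dvd:
  assumes "prime p" "of_nat p dvd w\<^sup>2" "w dvd (of_int l :: eisenstein)"
  shows "int p dvd l"
proof -
  have "of_nat p dvd (of_int l :: eisenstein)\<^sup>2"
    using assms(2,3) by (meson dvd_power_same dvd_trans)
  then have "of_int (int p) dvd (of_int (l\<^sup>2) :: eisenstein)"
    by simp
  then have "int p dvd l\<^sup>2"
    by (simp only: of_int_dvd_of_int_eisenstein_iff)
  then show ?thesis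
    using assms(1) by (simp add: prime_dvd_power_iff)
qed

text \<open>Here v is z alpha + z^-1 beta. With it, alpha X^2 + beta Y^2 - v X Y has the factor X -
  z Y, which the symbol relation controls; for X = alpha^n and Y = beta^n the form is the difference
  D to be shown divisible by p.\<close>

lemma jacobi_symbol_binomial_sum:
  fixes m v :: int
  assumes p: "prime p" "p > 3" and m: "\<not> int p dvd m\<^sup>2 + 3"
    and z: "cubic_jacobi (Eisenstein (m + 1) 2) p = z"
    and v: "Eisenstein (m + 1) 2 * z + eis_cnj (Eisenstein (m + 1) 2 * z) = of_int v"
  shows "int p dvd 2 * m * (\<Sum>k\<le>p div 3. int ((p div 3 + k) choose (2 * k)) * (- 12) ^ k
      * (m\<^sup>2 + 3) ^ (p div 3 - k)) - v * (m\<^sup>2 + 3) ^ (p div 3)"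
proof -
  define n \<alpha> \<beta> where "n = p div 3" and "\<alpha> = Eisenstein (m + 1) 2" and "\<beta> = eis_cnj \<alpha>"
  define T where "T = (\<Sum>k\<le>n. int ((n + k) choose (2 * k)) * (- 12) ^ k * (m\<^sup>2 + 3) ^ (n - k))"
  define D where "D = 2 * m * T - v * (m\<^sup>2 + 3) ^ n"
  have add: "\<alpha> + \<beta> = of_int (2 * m)" and diff: "(\<alpha> - \<beta>)\<^sup>2 = of_int (- 12)"
    and mult: "\<alpha> * \<beta> = of_int (m\<^sup>2 + 3)"
    unfolding \<alpha>_def \<beta>_def of_int_eisenstein
    by (simp_all add: eis_cnj_def eisenstein_defs power2_eq_square algebra_simps)
  have "int (eis_norm \<alpha>) = m\<^sup>2 + 3"
    unfolding int_eis_norm \<alpha>_def by (simp add: power2_eq_square algebra_simps)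
  then have "\<not> p dvd eis_norm \<alpha>"
    using m by (metis of_nat_dvd_iff)
  then have J: "jacobi_relation p \<alpha> z"
    unfolding z [symmetric] \<alpha>_def by (rule jacobi_relation_cubic_jacobi [OF p])
  then have unit: "z * eis_cnj z = 1"
    by (simp add: jacobi_relation_def cube_roots_cnj)
  have relation: "of_nat p dvd (if p mod 3 = 1
      then \<alpha> ^ n - z * \<beta> ^ n else \<beta> ^ Suc n - z * \<alpha> ^ Suc n)\<^sup>2"
    using J unfolding jacobi_relation_def n_def \<beta>_def by blast
  have trace: "\<alpha> * z + \<beta> * eis_cnj z = of_int v"
    using v by (simp add: \<alpha>_def \<beta>_def)
  have factor: "\<alpha> * X\<^sup>2 + \<beta> * Y\<^sup>2 - of_int v * (X * Y) = (X - z * Y) * (\<alpha> * X - \<beta> * eis_cnj z * Y)"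
    for X Y
  proof -
    have "(X - z * Y) * (\<alpha> * X - \<beta> * eis_cnj z * Y)
        = \<alpha> * X\<^sup>2 + (z * eis_cnj z) * (\<beta> * Y\<^sup>2) - (\<alpha> * z + \<beta> * eis_cnj z) * (X * Y)"
      by (simp add: power2_eq_square algebra_simps)
    then show ?thesis
      by (simp only: unit trace) simp
  qed
  have "(\<alpha> + \<beta>) * (\<Sum>k\<le>n. of_nat ((n + k) choose (2 * k)) * ((\<alpha> - \<beta>)\<^sup>2) ^ k * (\<alpha> * \<beta>) ^ (n - k))
      = of_int (2 * m * T)"
    unfolding add diff mult T_def by simp
  from this [unfolded binomial_sum_power_sum]
  have D: "of_int D = \<alpha> ^ (2 * n + 1) + \<beta> ^ (2 * n + 1) - of_int v * (\<alpha> * \<beta>) ^ n"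
    unfolding D_def mult by simp
  have "int p dvd D"
  proof (cases "p mod 3 = 1")
    case True
    have "of_int D = \<alpha> * (\<alpha> ^ n)\<^sup>2 + \<beta> * (\<beta> ^ n)\<^sup>2 - of_int v * (\<alpha> ^ n * \<beta> ^ n)"
      unfolding D by (simp add: power_mult_distrib power_mult [symmetric] mult.commute)
    then have "\<alpha> ^ n - z * \<beta> ^ n dvd of_int D"
      unfolding factor by simp
    then show ?thesis
      using relation True by (intro prime_dvd_if_square_dvd [OF p(1)]) simp_all
  next
    case False
    \<comment> \<open>The relation now has exponent n + 1 and the roles of the conjugates are
      exchanged; multiplying D by alpha beta = m^2 + 3, which p does not divide, makes it fit the
      same factorization.\<close>
    have "of_int ((m\<^sup>2 + 3) * D) = \<alpha> * \<beta> * of_int D"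
      by (simp only: of_int_mult mult)
    also have "\<dots> = \<alpha> * (\<beta> ^ Suc n)\<^sup>2 + \<beta> * (\<alpha> ^ Suc n)\<^sup>2 - of_int v * (\<beta> ^ Suc n * \<alpha> ^ Suc n)"
      unfolding D by (simp add: power_mult_distrib power_mult power2_eq_square algebra_simps)
    finally have "\<beta> ^ Suc n - z * \<alpha> ^ Suc n dvd of_int ((m\<^sup>2 + 3) * D)"
      unfolding factor by (simp del: power_Suc)
    then have "int p dvd (m\<^sup>2 + 3) * D"
      using relation False by (intro prime_dvd_if_square_dvd [OF p(1)]) (simp_all del: power_Suc)
    then show ?thesis
      using m p(1) by (metis prime_dvd_mult_iff prime_nat_int_transfer)
  qed
  then show ?thesis
    by (simp add: D_def T_def n_def)
qed

section \<open>Congruences between rationals\<close>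

context
  fixes p :: nat
  assumes prime_p: "prime p"
begin

lemma p_integralE:
  assumes "x \<in> p_integral p"
  obtains a b :: int where "x = of_int a / of_int b" "\<not> int p dvd b"
proof -
  obtain a b where "quotient_of x = (a, b)"
    by fastforce
  then show thesis
    using that [of a b] assms quotient_of_div [of x a b] by (simp add: p_integral_def)
qed

text \<open>\<open>p_integral\<close> inspects the reduced denominator, whereas fractions that arise
  from arithmetic are rarely reduced.\<close>

lemma p_integral_divide_of_int:
  assumes "\<not> int p dvd b"
  shows "of_int a / of_int b \<in> p_integral p"
proof -
  define x :: rat where "x = of_int a / of_int b"
  obtain c d where cd: "quotient_of x = (c, d)"
    by fastforce
  then have x: "x = of_int c / of_int d" and coprime: "coprime c d" and "d > 0"
    by (simp_all add: quotient_of_div quotient_of_coprime quotient_of_denom_pos)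
  have "b \<noteq> 0"
    using assms by auto
  then have "of_int (a * d) = (of_int (c * b) :: rat)"
    using x \<open>d > 0\<close> by (simp add: x_def field_simps)
  then have eq: "a * d = c * b"
    by (simp only: of_int_eq_iff)
  have "\<not> int p dvd d"
  proof
    assume d: "int p dvd d"
    then have "int p dvd c * b"
      unfolding eq [symmetric] by simp
    then have "int p dvd c"
      using assms prime_p by (simp add: prime_dvd_mult_iff)
    with d coprime have "is_unit (int p)"
      by (meson coprime_common_divisor)
    then show False
      using prime_p by simp
  qed
  then show ?thesis
    using cd by (simp add: p_integral_def x_def)
qed

lemma p_integral_of_int [simp]: "of_int a \<in> p_integral p"
  using p_integral_divide_of_int [of 1 a] prime_gt_1_nat [OF prime_p] by simp

lemma p_integral_numeral [simp]: "numeral k \<in> p_integral p"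
  using p_integral_of_int [of "numeral k"] by simp

lemma p_integral_1 [simp]: "1 \<in> p_integral p"
  using p_integral_of_int [of 1] by simp

lemma p_integral_mult [simp]:
  assumes "x \<in> p_integral p" "y \<in> p_integral p"
  shows "x * y \<in> p_integral p"
proof -
  obtain a b where "x = of_int a / of_int b" "\<not> int p dvd b"
    using assms(1) by (rule p_integralE)
  moreover obtain c d where "y = of_int c / of_int d" "\<not> int p dvd d"
    using assms(2) by (rule p_integralE)
  ultimately show ?thesis
    using p_integral_divide_of_int [of "b * d" "a * c"] prime_p by (simp add: prime_dvd_mult_iff)
qed

lemma p_integral_add [simp]:
  assumes "x \<in> p_integral p" "y \<in> p_integral p"
  shows "x + y \<in> p_integral p"
proof -
  obtain a b where x: "x = of_int a / of_int b" "\<not> int p dvd b"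
    using assms(1) by (rule p_integralE)
  obtain c d where y: "y = of_int c / of_int d" "\<not> int p dvd d"
    using assms(2) by (rule p_integralE)
  from x y have "b \<noteq> 0" "d \<noteq> 0"
    by auto
  then have "x + y = of_int (a * d + c * b) / of_int (b * d)"
    using x y by (simp add: field_simps)
  then show ?thesis
    using x y p_integral_divide_of_int [of "b * d" "a * d + c * b"] prime_p
    by (simp add: prime_dvd_mult_iff)
qed

lemma p_integral_uminus [simp]: "x \<in> p_integral p \<Longrightarrow> - x \<in> p_integral p"
  using p_integral_mult [of "of_int (- 1)" x] p_integral_of_int [of "- 1"] by simp

lemma p_integral_power [simp]: "x \<in> p_integral p \<Longrightarrow> x ^ k \<in> p_integral p"
  by (induction k) simp_all

lemma cong_p_of_int_iff: "cong_p p (of_int a) (of_int b) \<longleftrightarrow> int p dvd a - b"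
proof
  assume "cong_p p (of_int a) (of_int b)"
  then obtain z where "z \<in> p_integral p" and z: "of_int a - of_int b = of_nat p * z"
    by (auto simp: cong_p_def)
  then obtain c d where cd: "z = of_int c / of_int d" "\<not> int p dvd d"
    by (blast elim: p_integralE)
  then have "d \<noteq> 0"
    by auto
  then have "of_int ((a - b) * d) = (of_int (int p * c) :: rat)"
    using z cd by (simp add: field_simps)
  then have "(a - b) * d = int p * c"
    by (simp only: of_int_eq_iff)
  then have "int p dvd (a - b) * d"
    by simp
  then show "int p dvd a - b"
    using cd prime_p by (simp add: prime_dvd_mult_iff)
next
  assume "int p dvd a - b"
  then obtain c where "a - b = int p * c"
    by (elim dvdE)
  then have "of_int a - of_int b = (of_nat p * of_int c :: rat)"
    by (metis of_int_diff of_int_mult of_int_of_nat_eq)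
  then show "cong_p p (of_int a) (of_int b)"
    by (auto simp: cong_p_def)
qed

lemma cong_p_refl [simp]: "x \<in> p_integral p \<Longrightarrow> cong_p p x x"
  using p_integral_of_int [of 0] by (auto simp: cong_p_def intro!: bexI [of _ 0])

lemma cong_p_sym: "cong_p p x y \<Longrightarrow> cong_p p y x"
  unfolding cong_p_def by (metis minus_diff_eq mult_minus_right p_integral_uminus)

lemma cong_p_add:
  assumes "cong_p p x y" "cong_p p x' y'"
  shows "cong_p p (x + x') (y + y')"
proof -
  obtain z z' where "z \<in> p_integral p" "x - y = of_nat p * z" "z' \<in> p_integral p" "x' - y' = of_nat p * z'"
    using assms by (auto simp: cong_p_def)
  then have "z + z' \<in> p_integral p" "(x + x') - (y + y') = of_nat p * (z + z')"
    by (simp_all add: algebra_simps)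
  then show ?thesis
    using assms unfolding cong_p_def by (metis p_integral_add)
qed

lemma cong_p_mult:
  assumes "cong_p p x y" "cong_p p x' y'"
  shows "cong_p p (x * x') (y * y')"
proof -
  obtain z z' where z: "z \<in> p_integral p" "x - y = of_nat p * z" "z' \<in> p_integral p" "x' - y' = of_nat p * z'"
    using assms by (auto simp: cong_p_def)
  have integral: "x \<in> p_integral p" "y \<in> p_integral p" "x' \<in> p_integral p" "y' \<in> p_integral p"
    using assms by (auto simp: cong_p_def)
  have "x * x' - y * y' = (x - y) * x' + y * (x' - y')"
    by (simp add: algebra_simps)
  also have "\<dots> = of_nat p * (z * x' + y * z')"
    unfolding z by (simp add: algebra_simps)
  finally show ?thesis
    using z integral unfolding cong_p_def by (metis p_integral_add p_integral_mult)
qed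

lemma cong_p_trans:
  assumes "cong_p p x y" "cong_p p y z"
  shows "cong_p p x z"
proof -
  have "z \<in> p_integral p" "y \<in> p_integral p"
    using assms(2) by (auto simp: cong_p_def)
  then show ?thesis
    using cong_p_add [OF cong_p_add [OF assms] cong_p_refl [of "- y"]] by simp
qed

lemma cong_p_diff:
  assumes "cong_p p x y" "cong_p p x' y'"
  shows "cong_p p (x - x') (y - y')"
proof -
  have "cong_p p (of_int (- 1)) (of_int (- 1))"
    by simp
  from cong_p_add [OF assms(1) cong_p_mult [OF this assms(2)]] show ?thesis
    by simp
qed

lemma cong_p_power: "cong_p p x y \<Longrightarrow> cong_p p (x ^ k) (y ^ k)"
  by (induction k) (auto intro: cong_p_mult)

lemma cong_p_sum:
  assumes "\<And>i. i \<in> A \<Longrightarrow> cong_p p (f i) (g i)"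
  shows "cong_p p (sum f A) (sum g A)"
  using assms p_integral_of_int [of 0]
  by (induction A rule: infinite_finite_induct) (auto intro: cong_p_add)

lemma p_integral_inverse:
  assumes "x \<in> p_integral p" "\<not> cong_p p x 0"
  shows "inverse x \<in> p_integral p"
proof -
  obtain a b where x: "x = of_int a / of_int b" "\<not> int p dvd b"
    using assms(1) by (rule p_integralE)
  have "\<not> int p dvd a"
  proof
    assume "int p dvd a"
    then have "cong_p p (of_int a) (of_int 0)"
      by (simp only: cong_p_of_int_iff diff_zero)
    moreover have "of_int 1 / of_int b \<in> p_integral p"
      using x(2) by (rule p_integral_divide_of_int)
    ultimately have "cong_p p (of_int a * (of_int 1 / of_int b)) (of_int 0 * (of_int 1 / of_int b))"
      by (intro cong_p_mult cong_p_refl)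
    then show False
      using assms(2) x(1) by simp
  qed
  then show ?thesis
    using p_integral_divide_of_int [of a b] by (simp add: x(1))
qed

text \<open>Integrality of \<open>y\<close> and \<open>z\<close> is part of the conclusion:
  \<open>cong_p\<close> provides it for the products, and x is a unit. This is how the quotient by
  2c is later seen to be p-integral.\<close>

lemma cong_p_mult_cancel_left:
  assumes "x \<in> p_integral p" "\<not> cong_p p x 0" "cong_p p (x * y) (x * z)"
  shows "cong_p p y z"
proof -
  have "x \<noteq> 0"
    using assms by auto
  moreover have "cong_p p (inverse x * (x * y)) (inverse x * (x * z))"
    by (rule cong_p_mult [OF cong_p_refl [OF p_integral_inverse [OF assms(1,2)]] assms(3)])
  ultimately show ?thesis
    by (simp add: mult.assoc [symmetric])
qed

lemma cong_p_mult_0_iff: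
  assumes "x \<in> p_integral p" "y \<in> p_integral p"
  shows "cong_p p (x * y) 0 \<longleftrightarrow> cong_p p x 0 \<or> cong_p p y 0"
  using assms cong_p_mult [of x 0 y y] cong_p_mult [of x x y 0] cong_p_mult_cancel_left [of x y 0]
  by auto

lemma cong_p_power_0:
  assumes "x \<in> p_integral p" "\<not> cong_p p x 0"
  shows "\<not> cong_p p (x ^ k) 0"
proof (induction k)
  case 0
  show ?case
    using cong_p_of_int_iff [of 1 0] prime_gt_1_nat [OF prime_p] by simp
qed (use assms in \<open>simp add: cong_p_mult_0_iff\<close>)

lemma exists_int_cong_p:
  assumes "x \<in> p_integral p"
  obtains m where "cong_p p (of_int m) x"
proof -
  obtain a b where x: "x = of_int a / of_int b" "\<not> int p dvd b"
    using assms by (rule p_integralE)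
  then have "coprime b (int p)"
    using prime_p by (metis coprime_commute prime_imp_coprime prime_nat_int_transfer)
  then obtain b' where "[b * b' = 1] (mod int p)"
    using cong_solve_coprime_int by blast
  then have "cong_p p (of_int (a * (b * b'))) (of_int (a * 1))"
    unfolding cong_p_of_int_iff by (metis cong_iff_dvd_diff cong_scalar_left)
  moreover have "b \<noteq> 0"
    using x(2) by auto
  then have "of_int (a * (b * b')) = (of_int b * of_int (a * b') :: rat)"
    "of_int (a * 1) = of_int b * x"
    by (simp_all add: x(1))
  ultimately have "cong_p p (of_int b * of_int (a * b')) (of_int b * x)"
    by (simp only:)
  moreover have "\<not> cong_p p (of_int b) 0"
    using x(2) cong_p_of_int_iff [of b 0] by simp
  ultimately have "cong_p p (of_int (a * b')) x"
    using cong_p_mult_cancel_left [of "of_int b"] by simp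
  then show thesis
    by (rule that)
qed

lemma cubic_jacobi_rat_eq:
  assumes "cong_p p (of_int m) a" "cong_p p (of_int n) b"
  shows "cubic_jacobi_rat a b p = cubic_jacobi (Eisenstein m n) p"
  unfolding cubic_jacobi_rat_def
proof (rule the_equality)
  show "\<exists>m' n'. cong_p p (of_int m') a \<and> cong_p p (of_int n') b \<and>
      cubic_jacobi (Eisenstein m n) p = cubic_jacobi (Eisenstein m' n') p"
    using assms by blast
next
  fix z
  assume "\<exists>m' n'. cong_p p (of_int m') a \<and> cong_p p (of_int n') b \<and>
      z = cubic_jacobi (Eisenstein m' n') p"
  then obtain m' n' where *: "cong_p p (of_int m') a" "cong_p p (of_int n') b"
    and z: "z = cubic_jacobi (Eisenstein m' n') p"
    by blast
  have "int p dvd m' - m" "int p dvd n' - n"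
    using cong_p_trans [OF *(1) cong_p_sym [OF assms(1)]] cong_p_trans [OF *(2) cong_p_sym [OF assms(2)]]
    by (simp_all add: cong_p_of_int_iff)
  then show "z = cubic_jacobi (Eisenstein m n) p"
    unfolding z by (intro cubic_jacobi_cong) (simp add: of_nat_dvd_eisenstein_iff eisenstein_defs)
qed

text \<open>One statement serves all three classes: the trace of (m + 1 + 2 omega) omega^r is an
  affine function of m, and the integers \<open>v\<close> and \<open>v'\<close> record its
  coefficients.\<close>

lemma binomial_triple_sum_cong:
  fixes c :: rat and v v' :: int and r :: nat
  assumes p: "p > 3" and c: "c \<in> p_integral p" and nonzero: "\<not> cong_p p (c * (c\<^sup>2 + 3)) 0"
    and class_r: "c \<in> cubic_class r p"
    and trace: "\<And>m. Eisenstein (m + 1) 2 * omega ^ r + eis_cnj (Eisenstein (m + 1) 2 * omega ^ r)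
      = of_int (v * m + v')"
  shows "cong_p p (1 + (\<Sum>k = 1..p div 3. of_nat ((3 * k) choose k) * (4 / (9 * (c\<^sup>2 + 3))) ^ k))
    ((of_int v * c + of_int v') / (2 * c))"
proof -
  define n q where "n = p div 3" and "q = c\<^sup>2 + 3"
  define t where "t = 4 / (9 * q)"
  define S where "S = (\<Sum>k\<le>n. of_nat ((3 * k) choose k) * t ^ k)"
  obtain m where m: "cong_p p (of_int m) c"
    using exists_int_cong_p [OF c] .
  have integral_q: "q \<in> p_integral p"
    using c by (simp add: q_def)
  have unit_c: "\<not> cong_p p c 0" and unit_q: "\<not> cong_p p q 0"
    using nonzero c integral_q by (simp_all add: cong_p_mult_0_iff q_def)
  have unit: "\<not> cong_p p (numeral k) 0" if "\<not> p dvd numeral k" for k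
    using cong_p_of_int_iff [of "numeral k" 0] that int_dvd_int_iff [of p "numeral k"] by simp
  have "\<not> p dvd 3" "\<not> p dvd 2"
    using p by (auto dest: dvd_imp_le)
  moreover from this have "\<not> p dvd 9"
    using prime_dvd_mult_iff [of p 3 3] prime_p by simp
  ultimately have unit_9q: "\<not> cong_p p (9 * q) 0" and unit_2c: "\<not> cong_p p (2 * c) 0"
    using unit_c unit_q c integral_q by (simp_all add: cong_p_mult_0_iff unit)
  then have t: "t \<in> p_integral p"
    unfolding t_def divide_inverse using integral_q by (intro p_integral_mult p_integral_inverse) simp_all
  have "q \<noteq> 0"
    using unit_q p_integral_of_int [of 0] by auto
  have "c \<noteq> 0"
    using unit_c p_integral_of_int [of 0] by auto
  have q: "cong_p p q (of_int (m\<^sup>2 + 3))"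
    using cong_p_add [OF cong_p_power [OF cong_p_sym [OF m], of 2] cong_p_refl [of 3]]
    by (simp add: q_def)
  then have "\<not> cong_p p (of_int (m\<^sup>2 + 3)) (of_int 0)"
    using unit_q cong_p_trans by (metis of_int_0)
  then have m_unit: "\<not> int p dvd m\<^sup>2 + 3"
    by (simp only: cong_p_of_int_iff diff_zero not_False_eq_True)
  have "cong_p p (of_int (m + 1)) (c + 1)"
    using cong_p_add [OF m cong_p_refl [of 1]] by simp
  moreover have "cong_p p (of_int 2) 2"
    by simp
  ultimately have "cubic_jacobi_rat (c + 1) 2 p = cubic_jacobi (Eisenstein (m + 1) 2) p"
    by (rule cubic_jacobi_rat_eq)
  then have "cubic_jacobi (Eisenstein (m + 1) 2) p = omega ^ r"
    using class_r by (simp add: cubic_class_def)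
  from jacobi_symbol_binomial_sum [OF prime_p p m_unit this trace]
  have "cong_p p (of_int (2 * m * (\<Sum>k\<le>n. int ((n + k) choose (2 * k)) * (- 12) ^ k * (m\<^sup>2 + 3) ^ (n - k))))
      (of_int ((v * m + v') * (m\<^sup>2 + 3) ^ n))"
    by (simp only: cong_p_of_int_iff n_def)
  then have 1: "cong_p p (2 * of_int m *
        (\<Sum>k\<le>n. of_int (int ((n + k) choose (2 * k)) * (- 12) ^ k) * of_int (m\<^sup>2 + 3) ^ (n - k)))
      ((of_int v * of_int m + of_int v') * of_int (m\<^sup>2 + 3) ^ n)"
    by (simp only: of_int_mult of_int_sum of_int_power of_int_add of_int_numeral)
  \<comment> \<open>Multiplication by q^n leaves only nonnegative powers of q, so q can be replaced
    by the integer m^2 + 3.\<close>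
  have "q ^ n * (of_nat ((3 * k) choose k) * t ^ k) = of_nat ((3 * k) choose k) * ((4 / 9) ^ k * q ^ (n - k))"
    if "k \<le> n" for k
  proof -
    have "q ^ n = q ^ k * q ^ (n - k)"
      using that by (simp flip: power_add)
    then show ?thesis
      using \<open>q \<noteq> 0\<close> by (simp add: t_def power_divide power_mult_distrib)
  qed
  then have "q ^ n * S = (\<Sum>k\<le>n. of_nat ((3 * k) choose k) * ((4 / 9) ^ k * q ^ (n - k)))"
    unfolding S_def sum_distrib_left by (intro sum.cong refl) (simp only: atMost_iff)
  moreover have "cong_p p (of_nat ((3 * k) choose k) * ((4 / 9) ^ k * q ^ (n - k)))
      (of_int (int ((n + k) choose (2 * k)) * (- 12) ^ k) * of_int (m\<^sup>2 + 3) ^ (n - k))"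
    if "k \<le> n" for k
  proof -
    have ninth: "(4 / 9 :: rat) \<in> p_integral p"
      unfolding divide_inverse using \<open>\<not> p dvd 9\<close> by (intro p_integral_mult p_integral_inverse unit) simp_all
    have "cong_p p (of_int (int ((3 * k) choose k))) (of_int (int ((n + k) choose (2 * k)) * (- 27) ^ k))"
      using binomial_triple_cong [OF prime_p p, of k] that by (simp only: cong_p_of_int_iff n_def)
    then have "cong_p p (of_int (int ((3 * k) choose k)) * ((4 / 9) ^ k * q ^ (n - k)))
        (of_int (int ((n + k) choose (2 * k)) * (- 27) ^ k) * ((4 / 9) ^ k * of_int (m\<^sup>2 + 3) ^ (n - k)))"
      using ninth by (intro cong_p_mult cong_p_power q) simp_all
    moreover have "(- 27) ^ k * (4 / 9) ^ k = (- 12 :: rat) ^ k"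
      by (simp flip: power_mult_distrib)
    ultimately show ?thesis
      by (simp add: mult.assoc [symmetric])
        (simp add: mult.assoc)
  qed
  ultimately have sum: "cong_p p (q ^ n * S)
      (\<Sum>k\<le>n. of_int (int ((n + k) choose (2 * k)) * (- 12) ^ k) * of_int (m\<^sup>2 + 3) ^ (n - k))"
    by (simp only:) (rule cong_p_sum, simp)
  note cong_p_trans [trans]
  have "cong_p p (2 * c * (q ^ n * S)) (2 * of_int m *
      (\<Sum>k\<le>n. of_int (int ((n + k) choose (2 * k)) * (- 12) ^ k) * of_int (m\<^sup>2 + 3) ^ (n - k)))"
    by (intro cong_p_mult sum cong_p_sym [OF m] cong_p_refl) simp
  also note 1
  also have "cong_p p ((of_int v * of_int m + of_int v') * of_int (m\<^sup>2 + 3) ^ n)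
      ((of_int v * c + of_int v') * q ^ n)"
    by (intro cong_p_mult cong_p_add cong_p_power m cong_p_sym [OF q] cong_p_refl) simp_all
  also have "(of_int v * c + of_int v') * q ^ n
      = 2 * c * q ^ n * ((of_int v * c + of_int v') / (2 * c))"
    using \<open>c \<noteq> 0\<close> by (simp add: field_simps)
  finally have "cong_p p (2 * c * q ^ n * S)
      (2 * c * q ^ n * ((of_int v * c + of_int v') / (2 * c)))"
    by (simp only: mult.assoc)
  then have "cong_p p S ((of_int v * c + of_int v') / (2 * c))"
  proof (rule cong_p_mult_cancel_left [rotated 2])
    show "2 * c * q ^ n \<in> p_integral p"
      using c integral_q by simp
    then show "\<not> cong_p p (2 * c * q ^ n) 0"
      using unit_2c cong_p_power_0 [OF integral_q unit_q] cong_p_mult_0_iff [of "2 * c" "q ^ n"]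
        c integral_q by simp
  qed
  moreover have "S = 1 + (\<Sum>k = 1..n. of_nat ((3 * k) choose k) * t ^ k)"
    unfolding S_def atMost_atLeast0 by (subst sum.atLeast_Suc_atMost) simp_all
  ultimately show ?thesis
    by (simp only: n_def t_def q_def)
qed

end

theorem theorem2p5:
  fixes p :: nat and c :: rat
  assumes "prime p" and "p > 3"
    and "c \<in> p_integral p"
    and "\<not> cong_p p (c * (c\<^sup>2 + 3)) 0"
  shows "let S = (\<Sum>k = 1..p div 3. of_nat ((3 * k) choose k) * (4 / (9 * (c\<^sup>2 + 3))) ^ k) in
           (c \<in> cubic_class 0 p \<longrightarrow> cong_p p S 0) \<and>
           (c \<in> cubic_class 1 p \<longrightarrow> cong_p p S (- (3 * (c + 1) / (2 * c)))) \<and>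
           (c \<in> cubic_class 2 p \<longrightarrow> cong_p p S (- (3 * (c - 1) / (2 * c))))"
proof -
  define S where "S = (\<Sum>k = 1..p div 3. of_nat ((3 * k) choose k) * (4 / (9 * (c\<^sup>2 + 3))) ^ k)"
  have "c \<noteq> 0"
    using assms(4) cong_p_of_int_iff [OF assms(1), of 0 0] by auto
  \<comment> \<open>The subtracted 1 is the term k = 0, absent from the sum in the theorem. The
    pairs (v, v') used below are (2, 0), (-1, -3) and (-1, 3).\<close>
  have sum: "cong_p p S ((of_int v * c + of_int v') / (2 * c) - 1)"
    if "c \<in> cubic_class r p"
      "\<And>m. Eisenstein (m + 1) 2 * omega ^ r + eis_cnj (Eisenstein (m + 1) 2 * omega ^ r)
        = of_int (v * m + v')" for r v v'
    using cong_p_diff [OF assms(1) binomial_triple_sum_cong [OF assms that] cong_p_refl [OF assms(1), of 1]]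
      p_integral_1 [OF assms(1)] by (simp add: S_def)
  have "cong_p p S 0" if "c \<in> cubic_class 0 p"
    using sum [OF that, of 2 0] \<open>c \<noteq> 0\<close>
    by (simp add: of_int_eisenstein eis_cnj_def eisenstein_defs)
  moreover have "cong_p p S (- (3 * (c + 1) / (2 * c)))" if "c \<in> cubic_class 1 p"
  proof -
    have "(of_int (- 1) * c + of_int (- 3)) / (2 * c) - 1 = - (3 * (c + 1) / (2 * c))"
      using \<open>c \<noteq> 0\<close> by (simp add: field_simps)
    then show ?thesis
      using sum [OF that, of "- 1" "- 3"]
      by (simp add: of_int_eisenstein omega_def eis_cnj_def eisenstein_defs)
  qed
  moreover have "cong_p p S (- (3 * (c - 1) / (2 * c)))" if "c \<in> cubic_class 2 p"
  proof -
    have "(of_int (- 1) * c + of_int 3) / (2 * c) - 1 = - (3 * (c - 1) / (2 * c))"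
      using \<open>c \<noteq> 0\<close> by (simp add: field_simps)
    then show ?thesis
      using sum [OF that, of "- 1" 3]
      by (simp add: of_int_eisenstein omega_square eis_cnj_def eisenstein_defs)
  qed
  ultimately show ?thesis
    by (simp add: S_def)
qed

end
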